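(* Let $n\ge2$, $0\le l<k\le n$, $\theta\in(0,\pi)$, $p>k-l+1$, and let $f$ be a positive smooth function on $\mathcal{C}_\theta$. Then the positive admissible solution of $$\frac{\sigma_k(\nabla^2h+h\sigma)}{\sigma_l(\nabla^2h+h\sigma)}=f\,h^{p-1}\ \text{ in }\mathcal{C}_\theta,\qquad \nabla_\mu h=\cot\theta\, h\ \text{ on }\partial\mathcal{C}_\theta$$ is unique.
   Context: Let $e=-E_{n+1}$, $E_1,\dots,E_{n+1}$ the standard basis of $\mathbb{R}^{n+1}$, $\overline{\mathbb{R}^{n+1}_+}=\{x_{n+1}\ge0\}$. $\mathcal{C}_\theta=\{\xi\in\overline{\mathbb{R}^{n+1}_+}:|\xi-\cos\theta\,e|=1\}$ with round metric $\sigma$, connection $\nabla$, unit outward conormal $\mu$ of $\partial\mathcal{C}_\theta$. $\sigma_j(W)$ is the $j$-th elementary symmetric function of the eigenvalues of $W$ ($\sigma_0=1$); $\Gamma_k=\{\lambda\in\mathbb{R}^n:\sigma_i(\lambda)>0,1\le i\le k\}$; $h\in C^2(\mathcal{C}_\theta)$ is admissible if the eigenvalues of $\nabla^2h+h\sigma$ lie in $\Gamma_k$ everywhere. *)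

theory Defs
  imports "HOL-Analysis.Analysis"
begin

(* C^k regularity on a set U (intended: U open), via iterated Frechet directional derivatives *)
fun Ck :: "nat \<Rightarrow> ('a::real_normed_vector) set \<Rightarrow> ('a \<Rightarrow> real) \<Rightarrow> bool" where
  "Ck 0 U g = continuous_on U g"
| "Ck (Suc k) U g = (g differentiable_on U \<and>
      (\<forall>v. Ck k U (\<lambda>x. frechet_derivative g (at x) v)))"

definition Ck_on_set :: "nat \<Rightarrow> ('a::real_normed_vector) set \<Rightarrow> ('a \<Rightarrow> real) \<Rightarrow> bool" where
  "Ck_on_set k S g \<longleftrightarrow> (\<exists>U. open U \<and> S \<subseteq> U \<and> Ck k U g)"

definition smooth_on_set :: "('a::real_normed_vector) set \<Rightarrow> ('a \<Rightarrow> real) \<Rightarrow> bool" where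
  "smooth_on_set S g \<longleftrightarrow> (\<exists>U. open U \<and> S \<subseteq> U \<and> (\<forall>k. Ck k U g))"

(* Euclidean gradient and Hessian in R^{n+1} = real^'n *)
definition grad :: "(real^'n \<Rightarrow> real) \<Rightarrow> real^'n \<Rightarrow> real^'n" where
  "grad g x = (\<chi> i. frechet_derivative g (at x) (axis i 1))"

definition hess :: "(real^'n \<Rightarrow> real) \<Rightarrow> real^'n \<Rightarrow> real^'n^'n" where
  "hess g x = (\<chi> i j. frechet_derivative (\<lambda>y. frechet_derivative g (at y) (axis j 1)) (at x) (axis i 1))"

definition outer :: "real^'n \<Rightarrow> real^'n \<Rightarrow> real^'n^'n" where
  "outer u v = (\<chi> i j. u $ i * v $ j)"

definition esym :: "nat \<Rightarrow> real list \<Rightarrow> real" where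
  "esym j xs = (\<Sum>S\<in>{S. S \<subseteq> {..<length xs} \<and> card S = j}. \<Prod>i\<in>S. xs ! i)"

definition is_eigenvalue_list :: "real^'n^'n \<Rightarrow> real list \<Rightarrow> bool" where
  "is_eigenvalue_list M xs \<longleftrightarrow> length xs = CARD('n) \<and>
     (\<forall>t. det (mat t - M) = (\<Prod>i<length xs. t - xs ! i))"

definition sigma_mat :: "nat \<Rightarrow> real^'n^'n \<Rightarrow> real" where
  "sigma_mat j M = esym j (SOME xs. is_eigenvalue_list M xs)"

definition lastE :: "real^('n::{finite,linorder})" where
  "lastE = axis (Max (UNIV :: 'n set)) 1"

definition ee :: "real^('n::{finite,linorder})" where
  "ee = - lastE"

definition cap_center :: "real \<Rightarrow> real^('n::{finite,linorder})" where
  "cap_center \<theta> = cos \<theta> *\<^sub>R ee"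

definition cap :: "real \<Rightarrow> (real^('n::{finite,linorder})) set" where
  "cap \<theta> = {\<xi>. \<xi> \<bullet> lastE \<ge> 0 \<and> norm (\<xi> - cap_center \<theta>) = 1}"

definition cap_boundary :: "real \<Rightarrow> (real^('n::{finite,linorder})) set" where
  "cap_boundary \<theta> = {\<xi>. \<xi> \<bullet> lastE = 0 \<and> norm (\<xi> - cap_center \<theta>) = 1}"

definition sph_normal :: "real \<Rightarrow> real^('n::{finite,linorder}) \<Rightarrow> real^('n::{finite,linorder})" where
  "sph_normal \<theta> \<xi> = \<xi> - cap_center \<theta>"

definition conormal :: "real \<Rightarrow> real^('n::{finite,linorder}) \<Rightarrow> real^('n::{finite,linorder})" where
  "conormal \<theta> \<xi> = (let \<nu> = sph_normal \<theta> \<xi>; w = ee - (ee \<bullet> \<nu>) *\<^sub>R \<nu> in (1 / norm w) *\<^sub>R w)"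

(* the tensor \<nabla>^2 h + h \<sigma> at \<xi>, represented as a symmetric endomorphism of R^{n+1}
   acting on the tangent space T_\<xi> and by 0 on the normal direction.
   Uses: Hess_sphere h(X,Y) = D^2h(X,Y) - (\<partial>_\<nu> h) <X,Y> for tangent X,Y. *)
definition Wmat :: "real \<Rightarrow> (real^('n::{finite,linorder}) \<Rightarrow> real) \<Rightarrow> real^('n::{finite,linorder}) \<Rightarrow> real^('n::{finite,linorder})^('n::{finite,linorder})" where
  "Wmat \<theta> h \<xi> = (let \<nu> = sph_normal \<theta> \<xi>; P = mat 1 - outer \<nu> \<nu> in
      P ** (hess h \<xi> + (h \<xi> - grad h \<xi> \<bullet> \<nu>) *\<^sub>R mat 1) ** P)"

definition admissible :: "nat \<Rightarrow> real \<Rightarrow> (real^('n::{finite,linorder}) \<Rightarrow> real) \<Rightarrow> bool" where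
  "admissible k \<theta> h \<longleftrightarrow> Ck_on_set 2 (cap \<theta>) h \<and>
     (\<forall>\<xi>\<in>cap \<theta>. \<forall>i\<in>{1..k}. sigma_mat i (Wmat \<theta> h \<xi>) > 0)"

definition is_pos_adm_solution ::
  "nat \<Rightarrow> nat \<Rightarrow> real \<Rightarrow> real \<Rightarrow> (real^('n::{finite,linorder}) \<Rightarrow> real) \<Rightarrow> (real^('n::{finite,linorder}) \<Rightarrow> real) \<Rightarrow> bool" where
  "is_pos_adm_solution k l \<theta> p f h \<longleftrightarrow>
     admissible k \<theta> h \<and> (\<forall>\<xi>\<in>cap \<theta>. h \<xi> > 0) \<and>
     (\<forall>\<xi>\<in>cap \<theta>. sigma_mat k (Wmat \<theta> h \<xi>) / sigma_mat l (Wmat \<theta> h \<xi>) = f \<xi> * h \<xi> powr (p - 1)) \<and>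
     (\<forall>\<xi>\<in>cap_boundary \<theta>. frechet_derivative h (at \<xi>) (conormal \<theta> \<xi>) = cot \<theta> * h \<xi>)"

end

theory Submission
  imports Defs "HOL-Computational_Algebra.Fundamental_Theorem_Algebra"
begin

text \<open>At a maximum point \<open>\<xi>\<close> of \<open>h1 / h2\<close>, with maximum \<open>t\<close>, the function \<open>h1 - t * h2\<close> is
  nonpositive on the cap and vanishes at \<open>\<xi>\<close>.  Since the Robin condition is homogeneous, the gradient
  of this function along the cap vanishes at \<open>\<xi>\<close> even when \<open>\<xi>\<close> lies on the boundary, so its
  spherical Hessian is nonpositive there without any appeal to Hopf's lemma.  Hence
  \<open>W(h1) \<le> t W(h2)\<close> at \<open>\<xi>\<close>, and monotonicity of \<open>\<sigma>\<^sub>k / \<sigma>\<^sub>l\<close> on the cone \<open>\<Gamma>\<^sub>k\<close> turns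
  the equation into \<open>t powr (p - 1) \<le> t ^ (k - l)\<close>, that is \<open>t \<le> 1\<close>.\<close>

section \<open>Newton inequalities and the cone \<open>\<Gamma>\<^sub>k\<close>\<close>

text \<open>W(h1) and t W(h2) need not commute, so their order is first turned by Weyl's comparison
  into an entrywise inequality of ordered eigenvalues; these are then raised one at a time. A single
  raise is controlled by two consequences of Newton's inequalities: deleting an entry sends
  \<Gamma>_k into \<Gamma>_(k-1), and the ratios of consecutive elementary symmetric functions
  decrease. Only W(h1) has to lie in the cone at the start, since each raise preserves membership.
  The matrices act on all of R^(n+1); on the cap they carry an extra eigenvalue 0 in the normal
  direction, which leaves every elementary symmetric function unchanged. The power t ^ (k - l) is
  the homogeneity of \<sigma>_k / \<sigma>_l, and p - 1 > k - l is what rules out t > 1. Exchanging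
  h1 and h2 turns the resulting inequality into equality.\<close>

definition real_split :: "complex poly \<Rightarrow> bool" where
  "real_split p \<longleftrightarrow> (\<exists>c rs. p = smult c (\<Prod>r\<leftarrow>rs. [:- complex_of_real r, 1:]))"

text \<open>The case \<open>c = 0\<close> makes the class closed under derivation, constants
  included.\<close>

lemma real_split_0: "real_split 0"
  unfolding real_split_def by (rule exI[of _ 0]) simp

lemma real_split_mult:
  assumes "real_split p" "real_split q"
  shows "real_split (p * q)"
proof -
  obtain c rs d ss where "p = smult c (\<Prod>r\<leftarrow>rs. [:- complex_of_real r, 1:])"
    and "q = smult d (\<Prod>r\<leftarrow>ss. [:- complex_of_real r, 1:])"
    using assms unfolding real_split_def by auto
  then have "p * q = smult (c * d) (\<Prod>r\<leftarrow>rs @ ss. [:- complex_of_real r, 1:])"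
    by (simp add: mult_ac)
  then show ?thesis unfolding real_split_def by blast
qed

text \<open>The factor degenerates to the constant 1 at x = 0 and contributes no root there;
  otherwise its root is -1/x.\<close>

lemma real_split_one_plus: "real_split [:1, complex_of_real x:]"
proof (cases "x = 0")
  case True
  then have "[:1, complex_of_real x:] = smult 1 (\<Prod>r\<leftarrow>[]. [:- complex_of_real r, 1:])"
    by simp
  then show ?thesis unfolding real_split_def by blast
next
  case False
  then have "[:1, complex_of_real x:]
      = smult (of_real x) (\<Prod>r\<leftarrow>[- 1 / x]. [:- complex_of_real r, 1:])"
    by simp
  then show ?thesis unfolding real_split_def by blast
qed

text \<open>The Gauss--Lucas argument: every summand \<open>1 / (w - r)\<close> of the logarithmic derivative lies in the
  half plane opposite to \<open>w\<close>, so the derivative cannot vanish off the real axis.\<close>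
lemma logderiv_real_roots:
  fixes w :: complex
  assumes w: "Im w \<noteq> 0"
  defines "P \<equiv> \<lambda>rs. \<Prod>r\<leftarrow>rs. [:- complex_of_real r, 1:]"
  shows "poly (P rs) w \<noteq> 0 \<and> Im (poly (pderiv (P rs)) w / poly (P rs) w) * Im w \<le> 0 \<and>
    (rs \<noteq> [] \<longrightarrow> Im (poly (pderiv (P rs)) w / poly (P rs) w) * Im w < 0)"
proof (induction rs)
  case Nil
  then show ?case by (simp add: P_def)
next
  case (Cons r rs)
  let ?q = "P rs"
  have ne: "w - of_real r \<noteq> 0" using w by (auto simp: complex_eq_iff)
  have q: "poly ?q w \<noteq> 0" using Cons by simp
  have P: "P (r # rs) = [:- complex_of_real r, 1:] * ?q" by (simp add: P_def)
  have d: "poly (pderiv (P (r # rs))) w / poly (P (r # rs)) w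
      = 1 / (w - of_real r) + poly (pderiv ?q) w / poly ?q w"
    unfolding P pderiv_mult using ne q
    by (simp add: pderiv_pCons field_simps)
  have s: "(Re (w - of_real r))\<^sup>2 + (Im (w - of_real r))\<^sup>2 > 0"
    using w by (simp add: sum_power2_gt_zero_iff)
  then have "Im (1 / (w - of_real r)) * Im w < 0"
    using w by (auto simp add: Im_divide divide_simps power2_eq_square zero_less_mult_iff)
  \<comment> \<open>The tail may be empty and gives only a weak sign; the new factor supplies
    strictness.\<close>
  then have "Im (poly (pderiv (P (r # rs))) w / poly (P (r # rs)) w) * Im w < 0"
    unfolding d using Cons by (simp add: distrib_right)
  moreover have "poly (P (r # rs)) w \<noteq> 0" using ne q unfolding P by simp
  ultimately show ?case by simp
qed

text \<open>A nonzero logarithmic derivative off the real axis leaves only real roots for the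
  derivative, so its factorisation over the complex numbers is already of the required form.\<close>

lemma real_split_pderiv:
  assumes "real_split p"
  shows "real_split (pderiv p)"
proof (cases "pderiv p = 0")
  case True
  then show ?thesis by (simp add: real_split_0)
next
  case False
  obtain c rs where p: "p = smult c (\<Prod>r\<leftarrow>rs. [:- complex_of_real r, 1:])"
    using assms unfolding real_split_def by auto
  let ?P = "\<Prod>r\<leftarrow>rs. [:- complex_of_real r, 1:]"
  have c: "c \<noteq> 0" and rs: "rs \<noteq> []" using False p by auto
  have real: "Im w = 0" if "poly (pderiv p) w = 0" for w
  proof (rule ccontr)
    assume "Im w \<noteq> 0"
    from logderiv_real_roots[OF this, of rs] rs
    have "Im (poly (pderiv ?P) w / poly ?P w) \<noteq> 0" by auto
    then have "poly (pderiv ?P) w \<noteq> 0" by auto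
    then show False using that c by (simp add: p pderiv_smult)
  qed
  obtain root where root: "smult (lead_coeff (pderiv p)) (\<Prod>i<degree (pderiv p). [:- root i, 1:]) = pderiv p"
    using complex_poly_decompose' by blast
  have "of_real (Re (root i)) = root i" if "i < degree (pderiv p)" for i
  proof -
    have "poly (pderiv p) (root i) = 0"
      by (subst root[symmetric]) (use that in \<open>auto simp: poly_prod\<close>)
    then show ?thesis using real by (simp add: complex_eq_iff)
  qed
  then have "(\<Prod>i<degree (pderiv p). [:- root i, 1:])
      = (\<Prod>i<degree (pderiv p). [:- of_real (Re (root i)), 1:])"
    by (intro prod.cong) auto
  also have "\<dots> = (\<Prod>r\<leftarrow>map (\<lambda>i. Re (root i)) [0..<degree (pderiv p)]. [:- complex_of_real r, 1:])"
    by (simp add: o_def prod.list_conv_set_nth atLeast0LessThan)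
  finally show ?thesis unfolding real_split_def using root by metis
qed

text \<open>Away from the roots, (P')^2 - P P'' is P^2 times the sum of the 1/(x - r)^2. Adding a
  factor x - r to q turns the expression D for q into q^2 + (x - r)^2 D, which avoids division at
  the roots.\<close>

lemma laguerre_split:
  fixes rs :: "real list"
  defines "P \<equiv> \<lambda>rs. \<Prod>r\<leftarrow>rs. [:- complex_of_real r, 1:]"
  shows "\<exists>s\<ge>0. (poly (pderiv (P rs)) (of_real x))\<^sup>2
      - poly (P rs) (of_real x) * poly (pderiv (pderiv (P rs))) (of_real x) = complex_of_real s"
proof (induction rs)
  case Nil
  show ?case by (rule exI[of _ 0]) (simp add: P_def)
next
  case (Cons r rs)
  let ?q = "P rs"
  obtain s where s: "s \<ge> 0" "(poly (pderiv ?q) (of_real x))\<^sup>2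
      - poly ?q (of_real x) * poly (pderiv (pderiv ?q)) (of_real x) = complex_of_real s"
    using Cons by blast
  have P: "P (r # rs) = [:- complex_of_real r, 1:] * ?q" by (simp add: P_def)
  have "\<exists>a. poly ?q (of_real x) = complex_of_real a"
    unfolding P_def
    by (rule exI[of _ "\<Prod>r\<leftarrow>rs. x - r"], induction rs) (auto simp: algebra_simps)
  then obtain a where a: "poly ?q (of_real x) = complex_of_real a" by blast
  have "(poly (pderiv (P (r # rs))) (of_real x))\<^sup>2
      - poly (P (r # rs)) (of_real x) * poly (pderiv (pderiv (P (r # rs)))) (of_real x)
      = (poly ?q (of_real x))\<^sup>2 + (of_real (x - r))\<^sup>2 * ((poly (pderiv ?q) (of_real x))\<^sup>2
      - poly ?q (of_real x) * poly (pderiv (pderiv ?q)) (of_real x))"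
    unfolding P pderiv_mult pderiv_add
    by (simp add: pderiv_pCons pderiv_mult pderiv_add algebra_simps power2_eq_square)
  also have "\<dots> = of_real (a\<^sup>2 + (x - r)\<^sup>2 * s)" unfolding s(2) unfolding a by simp
  finally show ?case using s(1) by (intro exI[of _ "a\<^sup>2 + (x - r)\<^sup>2 * s"]) auto
qed

lemma coeff_higher_pderiv_fact:
  fixes p :: "complex poly"
  shows "coeff ((pderiv ^^ m) p) i * fact i = fact (m + i) * coeff p (m + i)"
proof (induction m arbitrary: i)
  case 0
  then show ?case by simp
next
  case (Suc m)
  have "coeff ((pderiv ^^ Suc m) p) i * fact i = coeff ((pderiv ^^ m) p) (Suc i) * fact (Suc i)"
    by (simp add: coeff_pderiv mult_ac)
  also have "\<dots> = fact (Suc m + i) * coeff p (Suc m + i)" using Suc[of "Suc i"] by simp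
  finally show ?case .
qed

section \<open>Elementary symmetric functions as polynomial coefficients\<close>

definition esym_poly :: "real list \<Rightarrow> real poly" where
  "esym_poly xs = (\<Prod>x\<leftarrow>xs. [:1, x:])"

text \<open>Expanding the product over subsets works without index reversal because the factors are
  1 + x z rather than z + x.\<close>

lemma coeff_esym_poly: "coeff (esym_poly xs) j = esym j xs"
proof -
  have "esym_poly xs = (\<Prod>i<length xs. [:0, xs ! i:] + 1)"
    unfolding esym_poly_def
    by (simp add: prod.list_conv_set_nth atLeast0LessThan one_pCons)
  also have "\<dots> = (\<Sum>S\<in>Pow {..<length xs}. \<Prod>i\<in>S. [:0, xs ! i:])"
    by (subst prod_add) auto
  also have "\<dots> = (\<Sum>S\<in>Pow {..<length xs}. monom (\<Prod>i\<in>S. xs ! i) (card S))"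
  proof (rule sum.cong)
    fix S assume "S \<in> Pow {..<length xs}"
    then have "finite S" using finite_subset by auto
    then show "(\<Prod>i\<in>S. [:0, xs ! i:]) = monom (\<Prod>i\<in>S. xs ! i) (card S)"
      by induction (auto simp: monom_Suc one_pCons monom_0 smult_monom)
  qed simp
  finally have "coeff (esym_poly xs) j
      = (\<Sum>S\<in>Pow {..<length xs}. if card S = j then \<Prod>i\<in>S. xs ! i else 0)"
    by (simp add: coeff_sum)
  also have "\<dots> = esym j xs"
    unfolding esym_def by (rule sum.mono_neutral_cong_right) auto
  finally show ?thesis .
qed

lemma esym_0 [simp]: "esym 0 xs = 1"
proof -
  have "{S. S \<subseteq> {..<length xs} \<and> card S = 0} = {{}}"
    using finite_subset[OF _ finite_lessThan] by auto
  then show ?thesis by (simp add: esym_def)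
qed

lemma esym_Cons: "esym (Suc j) (x # xs) = esym (Suc j) xs + x * esym j xs"
  unfolding coeff_esym_poly[symmetric] by (simp add: esym_poly_def coeff_pCons)

lemma esym_Nil_Suc [simp]: "esym (Suc j) [] = 0"
  unfolding coeff_esym_poly[symmetric] by (simp add: esym_poly_def)

text \<open>Brings an entry to the front, where the recursion \<open>esym_Cons\<close> applies to
  it.\<close>

lemma esym_append_Cons: "esym j (xs @ y # ys) = esym j (y # xs @ ys)"
proof -
  have "esym_poly (xs @ y # ys) = esym_poly (y # xs @ ys)"
    unfolding esym_poly_def map_append prod_list.append list.map prod_list.Cons
    by (rule mult.left_commute)
  then show ?thesis unfolding coeff_esym_poly[symmetric] by simp
qed

lemma esym_scale: "esym j (map ((*) t) xs) = t ^ j * esym j xs"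
proof (induction xs arbitrary: j)
  case Nil
  then show ?case by (cases j) auto
next
  case (Cons x xs)
  then show ?case by (cases j) (auto simp: esym_Cons algebra_simps)
qed

lemma map_poly_esym_poly:
  "map_poly complex_of_real (esym_poly xs) = (\<Prod>x\<leftarrow>xs. [:1, complex_of_real x:])"
proof (induction xs)
  case Nil
  then show ?case by (simp add: esym_poly_def)
next
  case (Cons x xs)
  have "map_poly complex_of_real (esym_poly (x # xs))
      = [:1, complex_of_real x:] * map_poly complex_of_real (esym_poly xs)"
    by (rule poly_eqI) (auto simp: esym_poly_def coeff_map_poly coeff_pCons split: nat.splits)
  then show ?case using Cons by simp
qed

text \<open>The generating polynomial of the \<open>esym j xs\<close> has only real roots, hence so has its \<open>j\<close>-th
  derivative, and Laguerre's inequality for the latter at 0 is the claim.\<close>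
lemma esym_newton:
  "esym j xs * esym (Suc (Suc j)) xs \<le> (esym (Suc j) xs)\<^sup>2"
proof (cases "esym j xs * esym (Suc (Suc j)) xs > 0")
  case False
  then show ?thesis by (smt (verit) zero_le_power2)
next
  case pos: True
  let ?p = "map_poly complex_of_real (esym_poly xs)"
  define q where "q = (pderiv ^^ j) ?p"
  have "real_split ?p"
    unfolding map_poly_esym_poly
  proof (induction xs)
    case Nil
    show ?case using real_split_one_plus[of 0] by (simp add: one_pCons)
  next
    case (Cons x xs)
    then show ?case using real_split_mult[OF real_split_one_plus[of x]] by simp
  qed
  then have "real_split q" unfolding q_def by (induction j) (auto intro: real_split_pderiv)
  then obtain c rs where q: "q = smult c (\<Prod>r\<leftarrow>rs. [:- complex_of_real r, 1:])"
    unfolding real_split_def by blast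
  let ?P = "\<Prod>r\<leftarrow>rs. [:- complex_of_real r, 1:]"
  obtain s where s: "s \<ge> 0" "(poly (pderiv ?P) 0)\<^sup>2 - poly ?P 0 * poly (pderiv (pderiv ?P)) 0 = complex_of_real s"
    using laguerre_split[of rs 0] by auto
  have cf: "coeff q i * fact i = complex_of_real (fact (j + i) * esym (j + i) xs)" for i
    using coeff_higher_pderiv_fact[of j ?p i] by (simp add: q_def coeff_map_poly coeff_esym_poly)
  have q0: "poly q 0 = of_real (fact j * esym j xs)"
    using cf[of 0] by (simp add: poly_0_coeff_0)
  have q1: "poly (pderiv q) 0 = of_real (fact (Suc j) * esym (Suc j) xs)"
    using cf[of 1] by (simp add: poly_0_coeff_0 coeff_pderiv)
  have q2: "poly (pderiv (pderiv q)) 0 = of_real (fact (Suc (Suc j)) * esym (Suc (Suc j)) xs)"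
    using cf[of 2] by (simp add: poly_0_coeff_0 coeff_pderiv numeral_2_eq_2 mult_ac)
  have e: "(poly (pderiv q) 0)\<^sup>2 - poly q 0 * poly (pderiv (pderiv q)) 0 = c\<^sup>2 * of_real s"
    unfolding s(2)[symmetric] by (simp add: q pderiv_smult power2_eq_square algebra_simps)
  \<comment> \<open>The leading factor \<open>c\<close> is a priori complex. As q(0) is real and
    nonzero and P(0) is real, \<open>c\<close> is real, so c^2 s is nonnegative.\<close>
  have "\<exists>a. poly ?P 0 = complex_of_real a"
    by (rule exI[of _ "\<Prod>r\<leftarrow>rs. - r"], induction rs) (auto simp: algebra_simps)
  then obtain a where a: "poly ?P 0 = complex_of_real a" by blast
  have "c * of_real a = of_real (fact j * esym j xs)" using q0 a by (simp add: q)
  moreover have "fact j * esym j xs \<noteq> 0" using pos by auto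
  ultimately have "a \<noteq> 0" and "c * of_real a = of_real (fact j * esym j xs)"
    by (auto simp del: of_real_mult)
  then have "c = of_real (fact j * esym j xs / a)" by (simp add: field_simps)
  then obtain d where d: "c = complex_of_real d" by blast
  have "(fact (Suc j) * esym (Suc j) xs)\<^sup>2 - (fact j * esym j xs) * (fact (Suc (Suc j)) * esym (Suc (Suc j)) xs) = d\<^sup>2 * s"
    using e unfolding q0 q1 q2 d by (metis of_real_diff of_real_mult of_real_power of_real_eq_iff)
  then have le: "(fact j * esym j xs) * (fact (Suc (Suc j)) * esym (Suc (Suc j)) xs) \<le> (fact (Suc j) * esym (Suc j) xs)\<^sup>2"
    using s(1) by (smt (verit) mult_nonneg_nonneg zero_le_power2)
  have "fact j * fact (Suc (Suc j)) \<ge> (fact (Suc j))\<^sup>2 * (1::real)"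
    by (simp add: power2_eq_square algebra_simps)
  then have "(fact (Suc j))\<^sup>2 * (esym j xs * esym (Suc (Suc j)) xs)
      \<le> (fact j * fact (Suc (Suc j))) * (esym j xs * esym (Suc (Suc j)) xs)"
    using pos by (intro mult_right_mono) auto
  also have "\<dots> \<le> (fact (Suc j))\<^sup>2 * (esym (Suc j) xs)\<^sup>2"
    using le by (simp only: power_mult_distrib mult_ac)
  finally have "(fact (Suc j))\<^sup>2 * (esym j xs * esym (Suc (Suc j)) xs) \<le> (fact (Suc j))\<^sup>2 * (esym (Suc j) xs)\<^sup>2" .
  then show ?thesis by (subst (asm) mult_le_cancel_left_pos) auto
qed


text \<open>The cone \<open>\<Gamma>\<^sub>k\<close>.\<close>
definition garding :: "nat \<Rightarrow> real list \<Rightarrow> bool" where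
  "garding k xs \<longleftrightarrow> (\<forall>j\<in>{1..k}. esym j xs > 0)"

lemma garding_pos: "garding k xs \<Longrightarrow> j \<le> k \<Longrightarrow> esym j xs > 0"
  unfolding garding_def by (cases "j = 0") auto

text \<open>Newton's inequality says that \<sigma>_(m+1) / \<sigma>_m decreases in m. The
  cross-multiplied form admits m = k, where \<sigma>_(k+1) may have any sign.\<close>

lemma garding_ratio_antimono:
  assumes "garding k xs" "l \<le> m" "m \<le> k"
  shows "esym l xs * esym (Suc m) xs \<le> esym (Suc l) xs * esym m xs"
  using assms(2,3)
proof (induction m rule: dec_induct)
  case base
  then show ?case by simp
next
  case (step m)
  have pos: "esym m xs > 0" "esym (Suc m) xs > 0" "esym l xs > 0"
    using step.hyps step.prems garding_pos[OF assms(1)] by simp_all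
  have "esym m xs * (esym l xs * esym (Suc (Suc m)) xs) \<le> esym l xs * (esym (Suc m) xs)\<^sup>2"
    using mult_left_mono[OF esym_newton[of m xs], of "esym l xs"] pos by (simp add: mult_ac)
  also have "\<dots> = (esym l xs * esym (Suc m) xs) * esym (Suc m) xs" by (simp add: power2_eq_square)
  also have "\<dots> \<le> (esym (Suc l) xs * esym m xs) * esym (Suc m) xs"
    using step pos by (intro mult_right_mono) auto
  finally have "esym m xs * (esym l xs * esym (Suc (Suc m)) xs) \<le> esym m xs * (esym (Suc l) xs * esym (Suc m) xs)"
    by (simp add: mult_ac)
  then show ?case using pos by simp
qed

text \<open>At the first j with \<sigma>_(j+1)(xs) \<le> 0, positivity of \<sigma>_(j+1) and
  \<sigma>_(j+2) on the full list would contradict Newton's inequality for xs. The use of index j +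
  2 costs one order.\<close>

lemma garding_Cons_tail:
  assumes "garding (Suc k) (x # xs)"
  shows "garding k xs"
proof -
  have "j \<le> k \<Longrightarrow> esym j xs > 0" for j
  proof (induction j)
    case (Suc j)
    then have j: "esym j xs > 0" by simp
    show ?case
    proof (rule ccontr)
      assume neg: "\<not> esym (Suc j) xs > 0"
      have 1: "esym (Suc j) xs + x * esym j xs > 0"
        and 2: "esym (Suc (Suc j)) xs + x * esym (Suc j) xs > 0"
        using garding_pos[OF assms] Suc.prems by (auto simp flip: esym_Cons)
      have "(esym (Suc j) xs)\<^sup>2 \<le> - (x * esym j xs) * esym (Suc j) xs"
        using 1 neg mult_right_mono_neg[of "- (x * esym j xs)" "esym (Suc j) xs" "esym (Suc j) xs"]
        by (simp add: power2_eq_square)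
      also have "\<dots> < esym j xs * esym (Suc (Suc j)) xs"
        using mult_strict_left_mono[OF 2 j] by (simp add: algebra_simps)
      also have "\<dots> \<le> (esym (Suc j) xs)\<^sup>2" by (rule esym_newton)
      finally show False by simp
    qed
  qed simp
  then show ?thesis unfolding garding_def by auto
qed

text \<open>The slope of \<sigma>_(i+1) in its first entry is \<sigma>_i of the tail, which is
  positive.\<close>

lemma garding_Cons_mono:
  assumes "garding k (a # xs)" "a \<le> c"
  shows "garding k (c # xs)"
  unfolding garding_def
proof
  fix j assume "j \<in> {1..k}"
  then obtain i where i: "j = Suc i" "Suc i \<le> k" by (cases j) auto
  then obtain k' where k: "k = Suc k'" by (cases k) auto
  have "garding k' xs" using garding_Cons_tail assms(1) unfolding k by blast
  then have "esym i xs > 0" using garding_pos i k by simp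
  then have "a * esym i xs \<le> c * esym i xs" using assms(2) by (simp add: mult_right_mono)
  moreover have "esym (Suc i) xs + a * esym i xs > 0"
    using garding_pos[OF assms(1), of "Suc i"] i by (simp add: esym_Cons)
  ultimately show "esym j (c # xs) > 0" by (simp add: i esym_Cons)
qed

text \<open>Numerator and denominator are affine in the first entry. With S_j taken on the tail,
  cross-multiplying leaves (c - a) (S_(k-1) S_l - S_k S_(l-1)), nonnegative by the decreasing
  ratios; for l = 0 the second product is absent.\<close>

lemma esym_quotient_Cons_mono:
  assumes "garding k (a # xs)" "a \<le> c" "l < k"
  shows "esym k (a # xs) / esym l (a # xs) \<le> esym k (c # xs) / esym l (c # xs)"
proof -
  obtain m where k: "k = Suc m" using assms(3) by (cases k) auto
  have g: "garding m xs" using garding_Cons_tail assms(1) unfolding k by blast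
  have pos: "esym l (a # xs) > 0" "esym l (c # xs) > 0"
    using garding_pos[OF assms(1)] garding_pos[OF garding_Cons_mono[OF assms(1,2)]] assms(3) by auto
  have "esym k (a # xs) * esym l (c # xs) \<le> esym k (c # xs) * esym l (a # xs)"
  proof (cases l)
    case 0
    then show ?thesis
      using assms(2) garding_pos[OF g, of m] by (simp add: k esym_Cons mult_right_mono)
  next
    case (Suc i)
    have "esym i xs * esym (Suc m) xs \<le> esym (Suc i) xs * esym m xs"
      using garding_ratio_antimono[OF g, of i m] assms(3) by (simp add: k Suc)
    then have "(c - a) * (esym i xs * esym (Suc m) xs) \<le> (c - a) * (esym (Suc i) xs * esym m xs)"
      using assms(2) by (intro mult_left_mono) auto
    then show ?thesis by (simp add: k Suc esym_Cons algebra_simps)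
  qed
  then show ?thesis using pos by (simp add: field_simps)
qed

lemma esym_quotient_mono:
  assumes "list_all2 (\<le>) as cs" "garding k as" "l < k"
  shows "garding k cs \<and> esym k as / esym l as \<le> esym k cs / esym l cs"
proof -
  \<comment> \<open>\<open>ps\<close> holds the entries already raised; the list stays in the cone
    after each raise.\<close>
  have "garding k (ps @ cs) \<and> esym k (ps @ as) / esym l (ps @ as) \<le> esym k (ps @ cs) / esym l (ps @ cs)"
    if "garding k (ps @ as)" for ps
    using assms(1) that
  proof (induction arbitrary: ps rule: list_all2_induct)
    case Nil
    then show ?case by simp
  next
    case (Cons a as c cs)
    have swap: "garding k (ps @ y # ys) = garding k (y # ps @ ys)" for y ys
      unfolding garding_def esym_append_Cons ..
    have "garding k (a # ps @ as)" using Cons.prems swap by simp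
    from garding_Cons_mono[OF this] esym_quotient_Cons_mono[OF this _ assms(3)] Cons.hyps(1)
    have "garding k (ps @ c # as)"
      and "esym k (ps @ a # as) / esym l (ps @ a # as) \<le> esym k (ps @ c # as) / esym l (ps @ c # as)"
      unfolding swap esym_append_Cons by auto
    then show ?case using Cons.IH[of "ps @ [c]"] by auto
  qed
  from this[of "[]"] assms(2) show ?thesis by simp
qed

section \<open>Eigenvalues of symmetric matrices\<close>

lemma symmetric_matrix_inner:
  fixes M :: "real^'n^'n"
  assumes "transpose M = M"
  shows "(M *v x) \<bullet> y = x \<bullet> (M *v y)"
  using dot_lmul_matrix[of x M y] transpose_matrix_vector[of M x] assms by simp

text \<open>A maximiser v of the quadratic form on the unit sphere of S is an eigenvector: the
  residual l v - M v lies in S, and moving v against it would exceed the maximum unless it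
  vanishes.\<close>

lemma symmetric_rayleigh_maximum:
  fixes M :: "real^'n^'n"
  assumes sym: "transpose M = M" and S: "subspace S" "\<And>x. x \<in> S \<Longrightarrow> M *v x \<in> S"
    and ne: "x0 \<in> S" "x0 \<noteq> 0"
  obtains v l where "v \<in> S" "norm v = 1" "M *v v = l *\<^sub>R v"
    "\<And>x. x \<in> S \<Longrightarrow> x \<bullet> (M *v x) \<le> l * (norm x)\<^sup>2"
proof -
  let ?K = "S \<inter> sphere 0 1"
  have "compact ?K" using closed_subspace[OF S(1)] by (simp add: closed_Int_compact)
  moreover have "x0 /\<^sub>R norm x0 \<in> ?K" using ne S(1) by (simp add: subspace_scale)
  moreover have "continuous_on ?K (\<lambda>x. x \<bullet> (M *v x))"
    by (intro continuous_intros linear_continuous_on matrix_vector_mul_bounded_linear)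
  ultimately obtain v where v: "v \<in> ?K" and vmax: "\<And>y. y \<in> ?K \<Longrightarrow> y \<bullet> (M *v y) \<le> v \<bullet> (M *v v)"
    using continuous_attains_sup[of ?K "\<lambda>x. x \<bullet> (M *v x)"] by blast
  define l where "l = v \<bullet> (M *v v)"
  have vS: "v \<in> S" and nv: "norm v = 1" using v by auto
  have bound: "x \<bullet> (M *v x) \<le> l * (norm x)\<^sup>2" if x: "x \<in> S" for x
  proof (cases "x = 0")
    case False
    let ?y = "x /\<^sub>R norm x"
    have "?y \<bullet> (M *v ?y) \<le> l"
      unfolding l_def by (rule vmax) (use x False S(1) in \<open>simp add: subspace_scale\<close>)
    then show ?thesis using False
      by (simp add: matrix_vector_mult_scaleR power2_eq_square field_simps)
  qed simp
  let ?d = "l *\<^sub>R v - M *v v"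
  have dS: "?d \<in> S" using S vS by (simp add: subspace_diff subspace_scale)
  have q: "0 \<le> 2 * s * (?d \<bullet> ?d) + s\<^sup>2 * (l * (norm ?d)\<^sup>2 - ?d \<bullet> (M *v ?d))" for s :: real
  proof -
    have "v + s *\<^sub>R ?d \<in> S" using dS vS S(1) by (simp add: subspace_add subspace_scale)
    from bound[OF this] have "0 \<le> l * ((v + s *\<^sub>R ?d) \<bullet> (v + s *\<^sub>R ?d)) - (v + s *\<^sub>R ?d) \<bullet> (M *v (v + s *\<^sub>R ?d))"
      by (simp add: power2_norm_eq_inner)
    also have "\<dots> = l * (v \<bullet> v + 2 * s * (v \<bullet> ?d) + s\<^sup>2 * (?d \<bullet> ?d))
       - (v \<bullet> (M *v v) + 2 * s * ((M *v v) \<bullet> ?d) + s\<^sup>2 * (?d \<bullet> (M *v ?d)))"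
      unfolding matrix_vector_right_distrib[of M v] matrix_vector_mult_scaleR
        inner_add_left inner_add_right inner_scaleR_left inner_scaleR_right
        symmetric_matrix_inner[OF sym, of v ?d, symmetric] inner_commute[of ?d "M *v v"] inner_commute[of ?d v]
      by (simp add: algebra_simps power2_eq_square)
    also have "v \<bullet> v = 1" using nv by (simp add: norm_eq_1)
    also have "v \<bullet> (M *v v) = l" by (simp add: l_def)
    also have "l * (1 + 2 * s * (v \<bullet> ?d) + s\<^sup>2 * (?d \<bullet> ?d)) - (l + 2 * s * ((M *v v) \<bullet> ?d) + s\<^sup>2 * (?d \<bullet> (M *v ?d)))
      = 2 * s * (l * (v \<bullet> ?d) - (M *v v) \<bullet> ?d) + s\<^sup>2 * (l * (norm ?d)\<^sup>2 - ?d \<bullet> (M *v ?d))"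
      unfolding power2_norm_eq_inner by (simp add: algebra_simps)
    also have "l * (v \<bullet> ?d) - (M *v v) \<bullet> ?d = ?d \<bullet> ?d" by (simp only: inner_diff_left inner_scaleR_left)
    finally show ?thesis .
  qed
  have "?d \<bullet> ?d = 0"
  proof (rule ccontr)
    define B where "B = l * (norm ?d)\<^sup>2 - ?d \<bullet> (M *v ?d)"
    define D where "D = ?d \<bullet> ?d"
    assume "?d \<bullet> ?d \<noteq> 0"
    then have D: "D > 0" unfolding D_def by (metis inner_gt_zero_iff inner_zero_left)
    have B: "B \<ge> 0" using bound[OF dS] by (simp add: B_def)
    \<comment> \<open>Near s = 0 the linear term 2 s D dominates s^2 B, so a small negative s
      contradicts the bound; B + 1 is used because B may be 0.\<close>
    have "0 \<le> 2 * (- (D / (B + 1))) * D + (- (D / (B + 1)))\<^sup>2 * B"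
      using q[of "- (D / (B + 1))"] unfolding B_def D_def .
    also have "\<dots> = D\<^sup>2 / (B + 1) * (B / (B + 1) - 2)"
      using B by (simp add: power2_eq_square divide_simps) (simp add: algebra_simps)
    also have "\<dots> < 0"
      using D B by (intro mult_pos_neg) (auto simp: field_simps)
    finally show False by simp
  qed
  then have "M *v v = l *\<^sub>R v" by simp
  then show thesis using that[OF vS nv] bound by blast
qed

text \<open>The last conjunct, the variational characterisation of the \<open>i\<close>-th eigenvalue, forces the
  eigenvalues to be listed in decreasing order.\<close>
definition eigensystem :: "real^'n^'n \<Rightarrow> nat \<Rightarrow> (nat \<Rightarrow> real^'n) \<Rightarrow> (nat \<Rightarrow> real) \<Rightarrow> bool" where
  "eigensystem M m u a \<longleftrightarrow>
     (\<forall>i<m. \<forall>j<m. u i \<bullet> u j = (if i = j then 1 else 0)) \<and>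
     (\<forall>i<m. M *v u i = a i *\<^sub>R u i) \<and>
     (\<forall>i<m. \<forall>x. (\<forall>j<i. x \<bullet> u j = 0) \<longrightarrow> x \<bullet> (M *v x) \<le> a i * (norm x)\<^sup>2)"

text \<open>The orthogonal complement of the eigenvectors found so far is invariant by symmetry and
  nonzero by dimension; its Rayleigh maximiser is the next one.\<close>

lemma eigensystem_exists:
  fixes M :: "real^'n^'n"
  assumes sym: "transpose M = M"
  shows "m \<le> CARD('n) \<Longrightarrow> \<exists>u a. eigensystem M m u a"
proof (induction m)
  case 0
  then show ?case by (simp add: eigensystem_def)
next
  case (Suc m)
  then obtain u a where ua: "eigensystem M m u a" by auto
  let ?S = "{x. \<forall>j<m. x \<bullet> u j = 0}"
  have "dim (u ` {..<m}) < DIM(real^'n)"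
    using dim_le_card'[of "u ` {..<m}"] card_image_le[of "{..<m}" u] Suc.prems by simp
  then obtain x0 where x0: "x0 \<noteq> 0" "\<And>y. y \<in> span (u ` {..<m}) \<Longrightarrow> orthogonal x0 y"
    using orthogonal_to_subspace_exists by blast
  have "x0 \<in> ?S" using x0(2) by (auto simp: orthogonal_def intro: span_base)
  moreover have "subspace ?S" by (auto simp: subspace_def inner_add_left)
  moreover have "M *v x \<in> ?S" if "x \<in> ?S" for x
    using that ua symmetric_matrix_inner[OF sym] by (simp add: eigensystem_def)
  ultimately obtain v l where v: "v \<in> ?S" "norm v = 1" "M *v v = l *\<^sub>R v"
    "\<And>x. x \<in> ?S \<Longrightarrow> x \<bullet> (M *v x) \<le> l * (norm x)\<^sup>2"
    using symmetric_rayleigh_maximum[OF sym, of ?S x0] x0(1) by blast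
  have "v \<bullet> v = 1" using v(2) by (simp add: norm_eq_1)
  then have "eigensystem M (Suc m) (u(m := v)) (a(m := l))"
    using ua v unfolding eigensystem_def by (auto simp: less_Suc_eq inner_commute)
  then show ?case by blast
qed

lemma eigensystem_antimono:
  assumes "eigensystem M m u a" "i \<le> j" "j < m"
  shows "a j \<le> a i"
proof -
  have "\<forall>k<i. u j \<bullet> u k = 0" using assms by (auto simp: eigensystem_def)
  then have "u j \<bullet> (M *v u j) \<le> a i * (norm (u j))\<^sup>2"
    using assms le_less_trans[OF assms(2,3)] unfolding eigensystem_def by blast
  moreover have "u j \<bullet> (M *v u j) = a j" and "(norm (u j))\<^sup>2 = 1"
    using assms(1,3) by (auto simp: eigensystem_def power2_norm_eq_inner)
  ultimately show ?thesis by simp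
qed

lemma orthonormal_family_independent:
  fixes u :: "nat \<Rightarrow> 'a::euclidean_space"
  assumes "\<And>i j. i < m \<Longrightarrow> j < m \<Longrightarrow> u i \<bullet> u j = (if i = j then 1 else 0)"
  shows "inj_on u {..<m} \<and> independent (u ` {..<m})"
proof
  show "inj_on u {..<m}"
    by (rule inj_onI) (metis assms lessThan_iff zero_neq_one)
  have "pairwise orthogonal (u ` {..<m})"
    using assms by (auto simp: pairwise_def orthogonal_def)
  moreover have "0 \<notin> u ` {..<m}" using assms by fastforce
  ultimately show "independent (u ` {..<m})" by (rule pairwise_orthogonal_independent)
qed

text \<open>Weyl's argument: the span of the first \<open>i + 1\<close> eigenvectors of \<open>A\<close> meets the orthogonal complement
  of the first \<open>i\<close> eigenvectors of \<open>B\<close> nontrivially.\<close>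
lemma eigenvalues_mono:
  fixes A B :: "real^'n^'n"
  assumes A: "eigensystem A CARD('n) u a" and B: "eigensystem B CARD('n) w b"
    and le: "\<And>x. x \<bullet> (A *v x) \<le> x \<bullet> (B *v x)" and i: "i < CARD('n)"
  shows "a i \<le> b i"
proof -
  let ?V = "span (u ` {..<Suc i})" and ?T = "span (w ` {..<i})"
  let ?W = "{y \<in> UNIV. \<forall>x\<in>?T. orthogonal x y}"
  have on: "u k \<bullet> u j = (if k = j then 1 else 0)" if "k < Suc i" "j < Suc i" for k j
    using A i that by (auto simp: eigensystem_def)
  have inj: "inj_on u {..<Suc i}" and ind: "independent (u ` {..<Suc i})"
    using orthonormal_family_independent[of "Suc i" u] on by auto
  have dV: "dim ?V = Suc i"
    using dim_eq_card_independent[OF ind] card_image[OF inj] by simp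
  have dT: "dim ?T \<le> i"
    using dim_le_card'[of "w ` {..<i}"] card_image_le[of "{..<i}" w] by simp
  have dW: "dim ?W + dim ?T = CARD('n)"
    using dim_subspace_orthogonal_to_vectors[of ?T "UNIV :: (real^'n) set"] by simp
  have sW: "subspace ?W" by (auto simp: subspace_def orthogonal_def inner_add_right)
  have "dim {x + y |x y. x \<in> ?V \<and> y \<in> ?W} + dim (?V \<inter> ?W) = dim ?V + dim ?W"
    by (rule dim_sums_Int) (use sW in auto)
  moreover have "dim {x + y |x y. x \<in> ?V \<and> y \<in> ?W} \<le> CARD('n)"
    using dim_subset_UNIV[of "{x + y |x y. x \<in> ?V \<and> y \<in> ?W}"] by simp
  \<comment> \<open>The dimensions i + 1 and at least N - i add up to more than N =
    \<open>CARD('n)\<close>.\<close>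
  ultimately have "dim (?V \<inter> ?W) \<noteq> 0" using dV dT dW by linarith
  then obtain x where x: "x \<in> ?V" "x \<in> ?W" "x \<noteq> 0" by (auto simp: dim_eq_0)
  obtain c where c: "x = (\<Sum>y\<in>u ` {..<Suc i}. c y *\<^sub>R y)"
    using x(1) span_finite[of "u ` {..<Suc i}"] by auto
  have xs: "x = (\<Sum>k<Suc i. c (u k) *\<^sub>R u k)" using c sum.reindex[OF inj] by (simp add: o_def)
  have xu: "x \<bullet> u j = c (u j)" if "j < Suc i" for j
  proof -
    have "x \<bullet> u j = (\<Sum>k<Suc i. c (u k) * (u k \<bullet> u j))"
      unfolding xs[symmetric] by (subst (1) xs) (simp only: inner_sum_left inner_scaleR_left)
    also have "\<dots> = (\<Sum>k<Suc i. if k = j then c (u k) else 0)"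
      using on that by (intro sum.cong) auto
    also have "\<dots> = c (u j)" using that by simp
    finally show ?thesis .
  qed
  have nx: "(norm x)\<^sup>2 = (\<Sum>k<Suc i. (c (u k))\<^sup>2)"
  proof -
    have "x \<bullet> x = (\<Sum>k<Suc i. c (u k) * (x \<bullet> u k))"
      by (subst (2) xs) (simp only: inner_sum_right inner_scaleR_right)
    also have "\<dots> = (\<Sum>k<Suc i. (c (u k))\<^sup>2)"
      by (intro sum.cong) (auto simp: xu power2_eq_square)
    finally show ?thesis by (simp add: power2_norm_eq_inner)
  qed
  have Ax: "A *v x = (\<Sum>k<Suc i. (c (u k) * a k) *\<^sub>R u k)"
    by (subst xs, subst linear_sum[OF matrix_vector_mul_linear])
       (use A i in \<open>auto simp: eigensystem_def matrix_vector_mult_scaleR intro!: sum.cong\<close>)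
  \<comment> \<open>For k \<le> i one has a k \<ge> a i, so the form of A at x is at least a i
    |x|^2, while that of B is at most b i |x|^2.\<close>
  have "a i * (norm x)\<^sup>2 = (\<Sum>k<Suc i. a i * (c (u k))\<^sup>2)" by (simp only: nx sum_distrib_left)
  also have "\<dots> \<le> (\<Sum>k<Suc i. a k * (c (u k))\<^sup>2)"
    using eigensystem_antimono[OF A] i by (intro sum_mono mult_right_mono) auto
  also have "\<dots> = (\<Sum>k<Suc i. (c (u k) * a k) * (x \<bullet> u k))"
    by (intro sum.cong) (auto simp: xu power2_eq_square)
  also have "\<dots> = x \<bullet> (A *v x)" unfolding Ax by (simp only: inner_sum_right inner_scaleR_right)
  also have "\<dots> \<le> x \<bullet> (B *v x)" by (rule le)
  also have "\<dots> \<le> b i * (norm x)\<^sup>2"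
  proof -
    have "x \<bullet> w j = 0" if "j < i" for j
      using x(2) that span_base[of "w j" "w ` {..<i}"] by (auto simp: orthogonal_def inner_commute)
    then show ?thesis using B i unfolding eigensystem_def by blast
  qed
  finally show ?thesis using x(3) by simp
qed

section \<open>From orthonormal eigenvectors to \<open>sigma_mat\<close>\<close>

lemma det_eigensystem:
  fixes M :: "real^'n^'n"
  assumes "eigensystem M CARD('n) u a"
  shows "is_eigenvalue_list M (map a [0..<CARD('n)])"
proof -
  obtain g :: "'n \<Rightarrow> nat" where g: "bij_betw g UNIV {0..<CARD('n)}"
    using ex_bij_betw_finite_nat[of "UNIV :: 'n set"] by auto
  have gl: "g i < CARD('n)" for i using bij_betwE[OF g] by auto
  have gi: "g i = g j \<longleftrightarrow> i = j" for i j using g by (auto simp: bij_betw_def inj_def)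
  \<comment> \<open>Q has the eigenvectors as columns, so (t - M) Q = Q D with D diagonal;
    \<open>g\<close> matches the column type with natural indices.\<close>
  define Q :: "real^'n^'n" where "Q = (\<chi> i j. u (g j) $ i)"
  have "transpose Q ** Q = mat 1"
    using assms gl gi
    by (simp add: vec_eq_iff matrix_matrix_mult_def transpose_def Q_def mat_def eigensystem_def
        inner_vec_def flip: inner_real_def)
  then have "det Q \<noteq> 0" by (metis det_I det_mul mult_zero_right zero_neq_one)
  have "det (mat t - M) = (\<Prod>i<CARD('n). t - map a [0..<CARD('n)] ! i)" for t
  proof -
    define D :: "real^'n^'n" where "D = (\<chi> i j. if i = j then t - a (g i) else 0)"
    have MQ: "(M *v u (g j)) $ i = a (g j) * u (g j) $ i" for i j
      using assms gl[of j] by (simp add: eigensystem_def)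
    have "((mat t - M) ** Q) $ i $ j = (Q ** D) $ i $ j" for i j
    proof -
      have "((mat t - M) ** Q) $ i $ j = t * u (g j) $ i - (M *v u (g j)) $ i"
        by (simp add: matrix_matrix_mult_def matrix_vector_mult_def Q_def mat_def left_diff_distrib
            sum_subtractf if_distrib[of "\<lambda>x. x * _"] cong: if_cong)
      also have "\<dots> = (Q ** D) $ i $ j"
        unfolding MQ by (simp add: matrix_matrix_mult_def D_def Q_def algebra_simps
          if_distrib[of "\<lambda>x. _ * x"] cong: if_cong)
      finally show ?thesis .
    qed
    then have "(mat t - M) ** Q = Q ** D" by (simp add: vec_eq_iff)
    then have "det (mat t - M) * det Q = det Q * det D" by (metis det_mul)
    then have "det (mat t - M) = det D" using \<open>det Q \<noteq> 0\<close> by simp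
    also have "\<dots> = (\<Prod>i\<in>UNIV. t - a (g i))"
      by (subst det_diagonal) (auto simp: D_def)
    also have "\<dots> = (\<Prod>i\<in>{0..<CARD('n)}. t - a i)"
      by (rule prod.reindex_bij_betw[OF g])
    also have "\<dots> = (\<Prod>i<CARD('n). t - map a [0..<CARD('n)] ! i)"
      by (intro prod.cong) auto
    finally show ?thesis .
  qed
  then show ?thesis by (simp add: is_eigenvalue_list_def)
qed

text \<open>Makes \<open>sigma_mat\<close> independent of its choice operator: at s \<noteq> 0 the
  generating polynomial is the characteristic polynomial at -1/s, rescaled.\<close>

lemma eigenvalue_list_esym_unique:
  fixes M :: "real^'n^'n"
  assumes "is_eigenvalue_list M xs" "is_eigenvalue_list M ys"
  shows "esym j xs = esym j ys"
proof -
  have eval: "poly (esym_poly zs) s = (- s) ^ CARD('n) * det (mat (- 1 / s) - M)"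
    if "is_eigenvalue_list M zs" "s \<noteq> 0" for zs s
  proof -
    have "poly (esym_poly zs) s = (\<Prod>i<length zs. 1 + s * zs ! i)"
      by (simp add: esym_poly_def prod.list_conv_set_nth atLeast0LessThan poly_prod)
    also have "\<dots> = (\<Prod>i<length zs. (- s) * (- 1 / s - zs ! i))"
      using that(2) by (intro prod.cong) (auto simp: field_simps)
    also have "\<dots> = (- s) ^ length zs * (\<Prod>i<length zs. - 1 / s - zs ! i)"
      by (simp only: prod.distrib prod_constant card_lessThan)
    finally show ?thesis using that(1) by (simp add: is_eigenvalue_list_def)
  qed
  \<comment> \<open>The extra factor z makes both sides vanish at s = 0, where -1/s gives no
    information.\<close>
  have "poly ([:0, 1:] * esym_poly xs) = poly ([:0, 1:] * esym_poly ys)"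
  proof
    fix s show "poly ([:0, 1:] * esym_poly xs) s = poly ([:0, 1:] * esym_poly ys) s"
      using eval[OF assms(1), of s] eval[OF assms(2), of s] by (cases "s = 0") auto
  qed
  then have "[:0, 1:] * esym_poly xs = [:0, 1:] * esym_poly ys" by (simp only: poly_eq_poly_eq_iff)
  then show ?thesis by (simp add: flip: coeff_esym_poly)
qed

lemma sigma_mat_eq:
  assumes "is_eigenvalue_list M xs"
  shows "sigma_mat j M = esym j xs"
  unfolding sigma_mat_def using assms
  by (intro eigenvalue_list_esym_unique) (rule someI)

text \<open>The eigenvalues of t B dominate those of A, so cone membership passes from A to t B;
  homogeneity then extracts t.\<close>

lemma sigma_mat_quotient_mono:
  fixes A B :: "real^'n^'n"
  assumes sym: "transpose A = A" "transpose B = B"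
    and le: "\<And>x. x \<bullet> (A *v x) \<le> t * (x \<bullet> (B *v x))" and t: "t > 0"
    and A: "\<forall>i\<in>{1..k}. sigma_mat i A > 0" and lk: "l < k"
  shows "sigma_mat k A / sigma_mat l A \<le> t ^ (k - l) * (sigma_mat k B / sigma_mat l B)"
proof -
  obtain u a where ua: "eigensystem A CARD('n) u a" using eigensystem_exists[OF sym(1)] by blast
  obtain w b where wb: "eigensystem B CARD('n) w b" using eigensystem_exists[OF sym(2)] by blast
  have "eigensystem (t *\<^sub>R B) CARD('n) w (\<lambda>i. t * b i)"
    using wb t unfolding eigensystem_def
    by (auto simp: scaleR_matrix_vector_assoc[symmetric] mult.assoc)
  moreover have "x \<bullet> (A *v x) \<le> x \<bullet> ((t *\<^sub>R B) *v x)" for x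
    using le by (simp add: scaleR_matrix_vector_assoc[symmetric])
  ultimately have le': "a i \<le> t * b i" if "i < CARD('n)" for i
    using eigenvalues_mono[OF ua] that by blast
  let ?as = "map a [0..<CARD('n)]" and ?bs = "map b [0..<CARD('n)]"
  have sA: "sigma_mat j A = esym j ?as" and sB: "sigma_mat j B = esym j ?bs" for j
    using sigma_mat_eq det_eigensystem ua wb by blast+
  have "list_all2 (\<le>) ?as (map ((*) t) ?bs)"
    by (rule list_all2_all_nthI) (auto simp: le')
  moreover have "garding k ?as" using A unfolding garding_def sA .
  ultimately have "esym k ?as / esym l ?as \<le> esym k (map ((*) t) ?bs) / esym l (map ((*) t) ?bs)"
    using esym_quotient_mono lk by blast
  also have "\<dots> = t ^ (k - l) * (esym k ?bs / esym l ?bs)"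
    using t lk by (simp only: esym_scale) (simp add: power_diff)
  finally show ?thesis unfolding sA sB .
qed

section \<open>Twice continuously differentiable functions\<close>

lemma frechet_derivative_eq_grad:
  fixes h :: "real^'n \<Rightarrow> real"
  assumes "h differentiable (at y)"
  shows "frechet_derivative h (at y) v = grad h y \<bullet> v"
proof -
  interpret linear "frechet_derivative h (at y)"
    using assms by (rule linear_frechet_derivative)
  have "v = (\<Sum>i\<in>UNIV. v $ i *\<^sub>R axis i 1)"
    by (simp add: basis_expansion flip: scalar_mult_eq_scaleR)
  then have "frechet_derivative h (at y) v = frechet_derivative h (at y) (\<Sum>i\<in>UNIV. v $ i *\<^sub>R axis i 1)"
    by simp
  also have "\<dots> = grad h y \<bullet> v"
    by (simp only: sum scale) (simp add: grad_def inner_vec_def mult.commute)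
  finally show ?thesis .
qed

lemma differentiable_has_derivative_grad:
  fixes h :: "real^'n \<Rightarrow> real"
  assumes "h differentiable (at y)"
  shows "(h has_derivative (\<lambda>v. grad h y \<bullet> v)) (at y)"
proof -
  have "frechet_derivative h (at y) = (\<lambda>v. grad h y \<bullet> v)"
    using frechet_derivative_eq_grad[OF assms] by (rule ext)
  then show ?thesis using assms frechet_derivative_works[of h "at y"] by simp
qed

context
  fixes U :: "(real^'n) set" and h :: "real^'n \<Rightarrow> real"
  assumes U: "open U" and C2: "Ck 2 U h"
begin

lemma C2_differentiable: "y \<in> U \<Longrightarrow> h differentiable (at y)"
  using C2 U by (simp add: numeral_2_eq_2 differentiable_on_eq_differentiable_at)

lemma C2_partial_differentiable:
  "y \<in> U \<Longrightarrow> (\<lambda>x. frechet_derivative h (at x) v) differentiable (at y)"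
  using C2 U by (simp add: numeral_2_eq_2 differentiable_on_eq_differentiable_at)

lemma C2_second_continuous:
  "continuous_on U (\<lambda>x. frechet_derivative (\<lambda>y. frechet_derivative h (at y) v) (at x) w)"
  using C2 by (simp add: numeral_2_eq_2)

lemma C2_has_derivative: "y \<in> U \<Longrightarrow> (h has_derivative (\<lambda>v. grad h y \<bullet> v)) (at y)"
  by (rule differentiable_has_derivative_grad[OF C2_differentiable])

text \<open>\<open>hess\<close> keeps the outer derivative in its row index, hence the
  transpose.\<close>

lemma C2_grad_has_derivative:
  assumes y: "y \<in> U"
  shows "(grad h has_derivative (\<lambda>w. transpose (hess h y) *v w)) (at y)"
proof -
  let ?p = "\<lambda>i x. frechet_derivative h (at x) (axis i 1)"
  have "(?p i has_derivative (\<lambda>w. grad (?p i) y \<bullet> w)) (at y)" for i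
    by (rule differentiable_has_derivative_grad[OF C2_partial_differentiable[OF y]])
  then have "((\<lambda>x. \<Sum>i\<in>UNIV. ?p i x *\<^sub>R (axis i 1 :: real^'n)) has_derivative
      (\<lambda>w. \<Sum>i\<in>UNIV. (grad (?p i) y \<bullet> w) *\<^sub>R axis i 1)) (at y)"
    by (auto intro!: derivative_eq_intros)
  moreover have "(\<lambda>x. \<Sum>i\<in>UNIV. ?p i x *\<^sub>R (axis i 1 :: real^'n)) = grad h"
    by (auto simp: fun_eq_iff vec_eq_iff grad_def axis_def if_distrib[of "\<lambda>x. _ * x"] cong: if_cong)
  moreover have "(\<lambda>w. \<Sum>i\<in>UNIV. (grad (?p i) y \<bullet> w) *\<^sub>R axis i 1) = (\<lambda>w. transpose (hess h y) *v w)"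
    by (auto simp: fun_eq_iff vec_eq_iff grad_def hess_def axis_def transpose_def inner_vec_def
        matrix_vector_mult_def if_distrib[of "\<lambda>x. _ * x"] cong: if_cong)
  ultimately show ?thesis by simp
qed

text \<open>Two mean value steps, along v and then along w, turn the second difference over a
  parallelogram into a mixed derivative.\<close>

lemma C2_second_difference:
  assumes ball: "ball x r \<subseteq> U" and s: "s > 0" "s * (norm v + norm w) < r"
  shows "\<exists>y\<in>ball x r. h (x + s *\<^sub>R v + s *\<^sub>R w) - h (x + s *\<^sub>R v) - h (x + s *\<^sub>R w) + h x
    = s\<^sup>2 * frechet_derivative (\<lambda>y. frechet_derivative h (at y) v) (at y) w"
proof -
  have mem: "x + a *\<^sub>R v + b *\<^sub>R w \<in> ball x r" if "0 \<le> a" "a \<le> s" "0 \<le> b" "b \<le> s" for a b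
  proof -
    have "norm (a *\<^sub>R v + b *\<^sub>R w) \<le> a * norm v + b * norm w"
      using norm_triangle_ineq[of "a *\<^sub>R v" "b *\<^sub>R w"] that by simp
    also have "\<dots> \<le> s * norm v + s * norm w"
      using that by (intro add_mono mult_right_mono) auto
    finally have "norm (a *\<^sub>R v + b *\<^sub>R w) < r" using s(2) by (simp add: algebra_simps)
    moreover have "x - (x + a *\<^sub>R v + b *\<^sub>R w) = - (a *\<^sub>R v + b *\<^sub>R w)" by simp
    ultimately show ?thesis unfolding mem_ball dist_norm by (simp only: norm_minus_cancel)
  qed
  let ?p = "\<lambda>y. frechet_derivative h (at y) v"
  have dh: "((\<lambda>a. h (x + a *\<^sub>R v + b *\<^sub>R w)) has_real_derivative ?p (x + a *\<^sub>R v + b *\<^sub>R w)) (at a)"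
    if "0 \<le> a" "a \<le> s" "0 \<le> b" "b \<le> s" for a b
  proof -
    have m: "x + a *\<^sub>R v + b *\<^sub>R w \<in> U" using mem that ball by auto
    have "((\<lambda>a. h (x + a *\<^sub>R v + b *\<^sub>R w)) has_derivative
        (\<lambda>t. grad h (x + a *\<^sub>R v + b *\<^sub>R w) \<bullet> (t *\<^sub>R v))) (at a)"
      by (rule has_derivative_compose[where g = h and f = "\<lambda>a. x + a *\<^sub>R v + b *\<^sub>R w", OF _ C2_has_derivative[OF m]]) (auto intro!: derivative_eq_intros)
    then show ?thesis
      by (rule has_derivative_imp_has_field_derivative)
         (simp add: frechet_derivative_eq_grad[OF C2_differentiable[OF m]])
  qed
  have dp: "((\<lambda>b. ?p (x + a *\<^sub>R v + b *\<^sub>R w)) has_real_derivative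
      frechet_derivative ?p (at (x + a *\<^sub>R v + b *\<^sub>R w)) w) (at b)"
    if "0 \<le> a" "a \<le> s" "0 \<le> b" "b \<le> s" for a b
  proof -
    have m: "x + a *\<^sub>R v + b *\<^sub>R w \<in> U" using mem that ball by auto
    have d: "(?p has_derivative (\<lambda>u. grad ?p (x + a *\<^sub>R v + b *\<^sub>R w) \<bullet> u)) (at (x + a *\<^sub>R v + b *\<^sub>R w))"
      by (rule differentiable_has_derivative_grad[OF C2_partial_differentiable[OF m]])
    have "((\<lambda>b. ?p (x + a *\<^sub>R v + b *\<^sub>R w)) has_derivative
        (\<lambda>t. grad ?p (x + a *\<^sub>R v + b *\<^sub>R w) \<bullet> (t *\<^sub>R w))) (at b)"
      by (rule has_derivative_compose[where g = ?p and f = "\<lambda>b. x + a *\<^sub>R v + b *\<^sub>R w", OF _ d]) (auto intro!: derivative_eq_intros)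
    then show ?thesis
      by (rule has_derivative_imp_has_field_derivative)
         (simp add: frechet_derivative_eq_grad[OF C2_partial_differentiable[OF m]])
  qed
  have "\<exists>z>0. z < s \<and> (h (x + s *\<^sub>R v + s *\<^sub>R w) - h (x + s *\<^sub>R v + 0 *\<^sub>R w))
      - (h (x + 0 *\<^sub>R v + s *\<^sub>R w) - h (x + 0 *\<^sub>R v + 0 *\<^sub>R w))
      = (s - 0) * (?p (x + z *\<^sub>R v + s *\<^sub>R w) - ?p (x + z *\<^sub>R v + 0 *\<^sub>R w))"
    using s(1) by (intro MVT2 DERIV_diff dh) auto
  then obtain z where z: "0 < z" "z < s" and e1: "h (x + s *\<^sub>R v + s *\<^sub>R w) - h (x + s *\<^sub>R v)
      - h (x + s *\<^sub>R w) + h x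
      = s * (?p (x + z *\<^sub>R v + s *\<^sub>R w) - ?p (x + z *\<^sub>R v + 0 *\<^sub>R w))"
    by auto
  have "\<exists>q>0. q < s \<and> ?p (x + z *\<^sub>R v + s *\<^sub>R w) - ?p (x + z *\<^sub>R v + 0 *\<^sub>R w)
      = (s - 0) * frechet_derivative ?p (at (x + z *\<^sub>R v + q *\<^sub>R w)) w"
    using s(1) z by (intro MVT2 dp) auto
  then obtain q where q: "0 < q" "q < s" and e2: "?p (x + z *\<^sub>R v + s *\<^sub>R w) - ?p (x + z *\<^sub>R v + 0 *\<^sub>R w)
      = s * frechet_derivative ?p (at (x + z *\<^sub>R v + q *\<^sub>R w)) w"
    by auto
  show ?thesis
    by (rule bexI[of _ "x + z *\<^sub>R v + q *\<^sub>R w"]) (use e1 e2 mem z q in \<open>auto simp: power2_eq_square\<close>)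
qed

text \<open>The second difference does not see the order of v and w, so the two mixed derivatives
  agree at points arbitrarily close to x, and continuity carries this to x.\<close>

lemma C2_hess_symmetric:
  assumes x: "x \<in> U"
  shows "transpose (hess h x) = hess h x"
proof -
  let ?D = "\<lambda>v w x. frechet_derivative (\<lambda>y. frechet_derivative h (at y) v) (at x) w"
  have "?D v w x = ?D w v x" for v w
  proof (rule ccontr)
    assume "?D v w x \<noteq> ?D w v x"
    define e where "e = \<bar>?D v w x - ?D w v x\<bar> / 2"
    have e: "e > 0" using \<open>?D v w x \<noteq> ?D w v x\<close> by (simp add: e_def)
    have cont: "\<exists>d>0. \<forall>y\<in>ball x d. \<bar>?D a b y - ?D a b x\<bar> < e" for a b
    proof -
      have "isCont (?D a b) x"
        using C2_second_continuous[of a b] x continuous_on_eq_continuous_at[OF U] by blast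
      then obtain d where "d > 0" "\<forall>y. dist y x < d \<longrightarrow> dist (?D a b y) (?D a b x) < e"
        using e unfolding continuous_at_eps_delta by blast
      then show ?thesis by (auto simp: dist_commute dist_real_def)
    qed
    then obtain d1 d2 where d: "d1 > 0" "d2 > 0" "\<And>y. y \<in> ball x d1 \<Longrightarrow> \<bar>?D v w y - ?D v w x\<bar> < e"
      "\<And>y. y \<in> ball x d2 \<Longrightarrow> \<bar>?D w v y - ?D w v x\<bar> < e"
      using cont[of v w] cont[of w v] by blast
    obtain d3 where d3: "d3 > 0" "ball x d3 \<subseteq> U" using U x open_contains_ball by blast
    define r where "r = min d3 (min d1 d2)"
    have r: "r > 0" "ball x r \<subseteq> U" "ball x r \<subseteq> ball x d1" "ball x r \<subseteq> ball x d2"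
      using d d3 by (auto simp: r_def)
    \<comment> \<open>The + 1 keeps N positive even for v = w = 0; s = r / (2 N) then keeps the
      parallelogram inside the ball.\<close>
    define N where "N = norm v + norm w + 1"
    have N: "N > 0" by (simp add: N_def add_nonneg_pos)
    define s where "s = r / (2 * N)"
    have s: "s > 0" using r N by (simp add: s_def)
    then have "s * (norm v + norm w) \<le> s * N" by (simp add: N_def)
    also have "\<dots> = r / 2" using N by (simp add: s_def)
    also have "\<dots> < r" using r by simp
    finally have sr: "s * (norm v + norm w) < r" .
    obtain y where y: "y \<in> ball x r" "h (x + s *\<^sub>R v + s *\<^sub>R w) - h (x + s *\<^sub>R v) - h (x + s *\<^sub>R w) + h x = s\<^sup>2 * ?D v w y"
      using C2_second_difference[OF r(2) s sr] by blast
    obtain y' where y': "y' \<in> ball x r" "h (x + s *\<^sub>R w + s *\<^sub>R v) - h (x + s *\<^sub>R w) - h (x + s *\<^sub>R v) + h x = s\<^sup>2 * ?D w v y'"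
      using C2_second_difference[OF r(2) s, of w v] sr by (auto simp: add.commute)
    have "h (x + s *\<^sub>R w + s *\<^sub>R v) = h (x + s *\<^sub>R v + s *\<^sub>R w)" by (simp add: add_ac)
    then have "s\<^sup>2 * ?D v w y = s\<^sup>2 * ?D w v y'" using y(2) y'(2) by linarith
    then have "?D v w y = ?D w v y'" using s by simp
    moreover have "\<bar>?D v w y - ?D v w x\<bar> < e" "\<bar>?D w v y' - ?D w v x\<bar> < e"
      using d(3,4) y(1) y'(1) r by auto
    ultimately show False unfolding e_def by argo
  qed
  then show ?thesis by (simp add: vec_eq_iff transpose_def hess_def)
qed

end

text \<open>Values are compared only for s \<ge> 0, since a curve starting on the boundary may leave
  the cap for s < 0. If g'(0) = 0 < q, then g' is positive just after 0 and g rises.\<close>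

lemma second_order_test_right:
  fixes g g' :: "real \<Rightarrow> real"
  assumes d: "d > 0" "\<And>s. 0 \<le> s \<Longrightarrow> s < d \<Longrightarrow> (g has_real_derivative g' s) (at s)"
    and q: "(g' has_real_derivative q) (at 0)" and le: "\<And>s. 0 \<le> s \<Longrightarrow> s < d \<Longrightarrow> g s \<le> g 0"
  shows "g' 0 \<le> 0" and "g' 0 = 0 \<Longrightarrow> q \<le> 0"
proof -
  show "g' 0 \<le> 0"
  proof (rule ccontr)
    assume "\<not> g' 0 \<le> 0"
    then obtain e where e: "e > 0" "\<And>h. 0 < h \<Longrightarrow> h < e \<Longrightarrow> g 0 < g (0 + h)"
      using DERIV_pos_inc_right[OF d(2)[of 0]] d(1) by force
    obtain s where "0 < s" "s < min d e" using dense[of 0 "min d e"] e(1) d(1) by auto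
    then show False using e(2)[of s] le[of s] by simp
  qed
  assume g0: "g' 0 = 0"
  show "q \<le> 0"
  proof (rule ccontr)
    assume "\<not> q \<le> 0"
    then obtain e where e: "e > 0" "\<And>h. 0 < h \<Longrightarrow> h < e \<Longrightarrow> 0 < g' h"
      using DERIV_pos_inc_right[OF q] g0 by force
    obtain s where "0 < s" "s < min d e" using dense[of 0 "min d e"] e(1) d(1) by auto
    then have s: "0 < s" "s < d" "s < e" by auto
    obtain z where "0 < z" "z < s" "g s - g 0 = (s - 0) * g' z"
      using MVT2[of 0 s g g'] d(2) s by (meson le_less_trans)
    then have "g s - g 0 > 0" using e(2)[of z] s by simp
    then show False using le[of s] s by simp
  qed
qed

section \<open>The spherical cap\<close>

text \<open>Differentiating \<open>h\<close> twice along the great circle \<open>c + cos s \<nu> + sin s v\<close> of the unit sphere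
  around \<open>c\<close>; the second derivative is the spherical Hessian of \<open>h\<close> at \<open>c + \<nu>\<close>.\<close>
lemma great_circle_derivatives:
  fixes h :: "real^'n \<Rightarrow> real" and c \<nu> v :: "real^'n"
  assumes U: "open U" "Ck 2 U h"
  defines "\<gamma> \<equiv> \<lambda>s. c + cos s *\<^sub>R \<nu> + sin s *\<^sub>R v"
    and "\<gamma>' \<equiv> \<lambda>s. cos s *\<^sub>R v - sin s *\<^sub>R \<nu>"
  shows "\<gamma> s \<in> U \<Longrightarrow> ((\<lambda>s. h (\<gamma> s)) has_real_derivative grad h (\<gamma> s) \<bullet> \<gamma>' s) (at s)"
    and "c + \<nu> \<in> U \<Longrightarrow> ((\<lambda>s. grad h (\<gamma> s) \<bullet> \<gamma>' s) has_real_derivative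
      v \<bullet> (hess h (c + \<nu>) *v v) - grad h (c + \<nu>) \<bullet> \<nu>) (at 0)"
proof -
  have \<gamma>: "(\<gamma> has_derivative (\<lambda>t. t *\<^sub>R \<gamma>' s)) (at s)" for s
    unfolding \<gamma>_def \<gamma>'_def
    by (auto intro!: derivative_eq_intros simp: fun_eq_iff algebra_simps)
  show "((\<lambda>s. h (\<gamma> s)) has_real_derivative grad h (\<gamma> s) \<bullet> \<gamma>' s) (at s)" if "\<gamma> s \<in> U"
    using has_derivative_compose[where g = h and f = \<gamma>, OF \<gamma> C2_has_derivative[OF U that]]
    by (rule has_derivative_imp_has_field_derivative) simp
  assume m: "c + \<nu> \<in> U"
  have \<gamma>0: "\<gamma> 0 = c + \<nu>" "\<gamma>' 0 = v" by (simp_all add: \<gamma>_def \<gamma>'_def)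
  have "((\<lambda>s. grad h (\<gamma> s)) has_derivative (\<lambda>t. transpose (hess h (c + \<nu>)) *v (t *\<^sub>R v))) (at 0)"
    using has_derivative_compose[where g = "grad h" and f = \<gamma>, OF \<gamma>[of 0]] C2_grad_has_derivative[OF U m]
    unfolding \<gamma>0 by blast
  moreover have "(\<gamma>' has_derivative (\<lambda>t. - t *\<^sub>R \<nu>)) (at 0)"
    unfolding \<gamma>'_def by (auto intro!: derivative_eq_intros)
  ultimately have d: "((\<lambda>s. grad h (\<gamma> s) \<bullet> \<gamma>' s) has_derivative
      (\<lambda>t. grad h (\<gamma> 0) \<bullet> (- t *\<^sub>R \<nu>) + (transpose (hess h (c + \<nu>)) *v (t *\<^sub>R v)) \<bullet> \<gamma>' 0)) (at 0)"
    by (rule has_derivative_inner)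
  have t: "(transpose (hess h (c + \<nu>)) *v (t *\<^sub>R v)) \<bullet> v = t * (v \<bullet> (hess h (c + \<nu>) *v v))" for t
    by (simp add: matrix_vector_mult_scaleR transpose_matrix_vector dot_lmul_matrix)
  show "((\<lambda>s. grad h (\<gamma> s) \<bullet> \<gamma>' s) has_real_derivative
      v \<bullet> (hess h (c + \<nu>) *v v) - grad h (c + \<nu>) \<bullet> \<nu>) (at 0)"
    using d unfolding \<gamma>0 t
    by (rule has_derivative_imp_has_field_derivative) (simp add: algebra_simps)
qed

lemma lastE_inner_lastE: "lastE \<bullet> lastE = 1"
  by (simp add: lastE_def inner_axis_axis)

lemma sph_normal_lastE:
  "sph_normal \<theta> \<xi> \<bullet> lastE = \<xi> \<bullet> lastE + cos \<theta>"
  by (simp add: sph_normal_def cap_center_def ee_def inner_diff_left inner_add_left lastE_inner_lastE)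

lemma compact_cap: "compact (cap \<theta> :: (real^'n::{finite,linorder}) set)"
proof -
  have "(cap \<theta> :: (real^'n::{finite,linorder}) set) = {\<xi>. \<xi> \<bullet> lastE \<ge> 0} \<inter> sphere (cap_center \<theta>) 1"
    by (auto simp: cap_def dist_norm norm_minus_commute)
  moreover have "closed {\<xi>. \<xi> \<bullet> (lastE :: real^'n::{finite,linorder}) \<ge> 0}"
    by (intro closed_Collect_le continuous_intros)
  ultimately show ?thesis by (simp add: closed_Int_compact)
qed

text \<open>Orthonormality keeps the curve on the sphere. Its height stays nonnegative by continuity
  at interior points, and by its positive initial slope at boundary points.\<close>

lemma great_circle_in_cap:
  assumes \<xi>: "\<xi> \<in> cap \<theta>" and v: "norm v = 1" "v \<bullet> sph_normal \<theta> \<xi> = 0"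
    and inward: "\<xi> \<bullet> lastE > 0 \<or> v \<bullet> lastE > 0"
  shows "\<exists>d>0. \<forall>s. 0 \<le> s \<and> s < d \<longrightarrow>
    cap_center \<theta> + cos s *\<^sub>R sph_normal \<theta> \<xi> + sin s *\<^sub>R v \<in> cap \<theta>"
proof -
  let ?\<nu> = "sph_normal \<theta> \<xi>"
  define \<gamma> where "\<gamma> = (\<lambda>s. cap_center \<theta> + cos s *\<^sub>R ?\<nu> + sin s *\<^sub>R v)"
  have n: "?\<nu> \<bullet> ?\<nu> = 1" using \<xi> by (simp add: cap_def sph_normal_def norm_eq_1)
  have "(norm (\<gamma> s - cap_center \<theta>))\<^sup>2 = (cos s)\<^sup>2 + (sin s)\<^sup>2" for s
    using n v unfolding \<gamma>_def power2_norm_eq_inner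
    by (simp add: inner_add_left inner_add_right inner_commute[of ?\<nu> v] norm_eq_1 power2_eq_square)
  then have sph: "norm (\<gamma> s - cap_center \<theta>) = 1" for s
    by (simp add: power2_eq_1_iff) (smt (verit) norm_ge_zero)
  have \<gamma>0: "\<gamma> 0 = \<xi>" by (simp add: \<gamma>_def sph_normal_def)
  have "\<exists>d>0. \<forall>s. 0 < s \<and> s < d \<longrightarrow> \<gamma> s \<bullet> lastE \<ge> 0"
  proof (cases "\<xi> \<bullet> lastE > 0")
    case True
    have "isCont (\<lambda>s. \<gamma> s \<bullet> lastE) 0" unfolding \<gamma>_def by (intro continuous_intros)
    then obtain d where "d > 0" "\<forall>s. dist s 0 < d \<longrightarrow> dist (\<gamma> s \<bullet> lastE) (\<xi> \<bullet> lastE) < \<xi> \<bullet> lastE"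
      using True \<gamma>0 unfolding continuous_at_eps_delta by metis
    then have "\<gamma> s \<bullet> lastE \<ge> 0" if "0 < s \<and> s < d" for s
      using that by (auto simp: dist_real_def dest!: spec[of _ s])
    then show ?thesis using \<open>d > 0\<close> by blast
  next
    case False
    then have z: "\<xi> \<bullet> lastE = 0" and vE: "v \<bullet> lastE > 0" using \<xi> inward by (auto simp: cap_def)
    have "((\<lambda>s. \<gamma> s \<bullet> lastE) has_real_derivative v \<bullet> lastE) (at 0)"
      unfolding \<gamma>_def inner_add_left inner_scaleR_left by (auto intro!: derivative_eq_intros)
    from DERIV_pos_inc_right[OF this vE] \<gamma>0 z show ?thesis by force
  qed
  then obtain d where "d > 0" "\<And>s. 0 < s \<Longrightarrow> s < d \<Longrightarrow> \<gamma> s \<bullet> lastE \<ge> 0" by blast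
  moreover have "\<gamma> 0 \<in> cap \<theta>" using \<gamma>0 \<xi> by simp
  ultimately have "\<forall>s. 0 \<le> s \<and> s < d \<longrightarrow> \<gamma> s \<in> cap \<theta>"
    using sph by (metis (mono_tags, lifting) cap_def mem_Collect_eq order_le_less)
  then show ?thesis using \<open>d > 0\<close> unfolding \<gamma>_def by blast
qed

text \<open>The conormal is the normalised tangential part of e, whose component along
  \<open>lastE\<close> before normalisation is -1 + cos^2 \<theta> = -sin^2 \<theta>.\<close>

lemma conormal_properties:
  assumes \<theta>: "0 < \<theta>" "\<theta> < pi" and \<xi>: "\<xi> \<in> cap_boundary \<theta>"
  shows "conormal \<theta> \<xi> \<bullet> sph_normal \<theta> \<xi> = 0" and "conormal \<theta> \<xi> \<bullet> lastE < 0"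
proof -
  let ?\<nu> = "sph_normal \<theta> \<xi>"
  define w where "w = ee - (ee \<bullet> ?\<nu>) *\<^sub>R ?\<nu>"
  have c: "conormal \<theta> \<xi> = (1 / norm w) *\<^sub>R w" by (simp add: conormal_def w_def Let_def)
  have n: "?\<nu> \<bullet> ?\<nu> = 1" using \<xi> by (simp add: cap_boundary_def sph_normal_def norm_eq_1)
  have nE: "?\<nu> \<bullet> lastE = cos \<theta>" using \<xi> by (simp add: sph_normal_lastE cap_boundary_def)
  have "w \<bullet> lastE = - 1 + (cos \<theta>)\<^sup>2"
    using nE
    by (simp add: w_def ee_def inner_diff_left lastE_inner_lastE inner_commute[of lastE ?\<nu>] power2_eq_square)
  also have "\<dots> = - (sin \<theta>)\<^sup>2" using sin_cos_squared_add[of \<theta>] by linarith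
  finally have wE: "w \<bullet> lastE < 0" using sin_gt_zero[OF \<theta>] by simp
  then have "norm w > 0" by auto
  then show "conormal \<theta> \<xi> \<bullet> lastE < 0" using wE by (simp add: c divide_neg_pos)
  show "conormal \<theta> \<xi> \<bullet> ?\<nu> = 0" using n by (simp add: c w_def inner_diff_left)
qed

section \<open>Comparison at a touching point\<close>

lemma outer_self_vector_mult: "outer \<nu> \<nu> *v x = (\<nu> \<bullet> x) *\<^sub>R \<nu>"
  by (simp add: vec_eq_iff outer_def matrix_vector_mult_def inner_vec_def sum_distrib_left mult_ac)

lemma transpose_tangent_projection: "transpose (mat 1 - outer \<nu> \<nu>) = mat 1 - outer \<nu> \<nu>"
  by (auto simp: vec_eq_iff transpose_def mat_def outer_def)

lemma transpose_Wmat: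
  assumes "transpose (hess h \<xi>) = hess h \<xi>"
  shows "transpose (Wmat \<theta> h \<xi>) = Wmat \<theta> h \<xi>"
proof -
  define K where "K = hess h \<xi> + (h \<xi> - grad h \<xi> \<bullet> sph_normal \<theta> \<xi>) *\<^sub>R mat 1"
  have "transpose K = K"
    using assms by (auto simp: K_def vec_eq_iff transpose_def mat_def)
  then show ?thesis
    unfolding Wmat_def Let_def K_def[symmetric]
    by (simp add: matrix_transpose_mul transpose_tangent_projection matrix_mul_assoc)
qed

text \<open>The projection is symmetric and can be moved onto x, so only the tangential part y
  counts.\<close>

lemma Wmat_quadratic_form:
  fixes x \<xi> :: "real^'n::{finite,linorder}" and \<theta> :: real
  defines "y \<equiv> x - (sph_normal \<theta> \<xi> \<bullet> x) *\<^sub>R sph_normal \<theta> \<xi>"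
  shows "x \<bullet> (Wmat \<theta> h \<xi> *v x)
    = y \<bullet> (hess h \<xi> *v y) + (h \<xi> - grad h \<xi> \<bullet> sph_normal \<theta> \<xi>) * (y \<bullet> y)"
proof -
  let ?\<nu> = "sph_normal \<theta> \<xi>"
  define P where "P = mat 1 - outer ?\<nu> ?\<nu>"
  define a where "a = h \<xi> - grad h \<xi> \<bullet> ?\<nu>"
  have P: "P *v z = z - (?\<nu> \<bullet> z) *\<^sub>R ?\<nu>" for z
    by (simp add: P_def matrix_vector_mult_diff_rdistrib outer_self_vector_mult)
  have "x \<bullet> (Wmat \<theta> h \<xi> *v x) = x \<bullet> (P *v ((hess h \<xi> + a *\<^sub>R mat 1) *v (P *v x)))"
    by (simp add: Wmat_def Let_def P_def a_def matrix_vector_mul_assoc matrix_mul_assoc)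
  also have "\<dots> = (P *v x) \<bullet> ((hess h \<xi> + a *\<^sub>R mat 1) *v (P *v x))"
    by (rule symmetric_matrix_inner[symmetric]) (simp add: P_def transpose_tangent_projection)
  also have "\<dots> = y \<bullet> ((hess h \<xi> + a *\<^sub>R mat 1) *v y)" unfolding P y_def ..
  also have "\<dots> = y \<bullet> (hess h \<xi> *v y) + a * (y \<bullet> y)"
    by (simp add: matrix_vector_mult_add_rdistrib inner_add_right flip: scaleR_matrix_vector_assoc)
  finally show ?thesis unfolding a_def .
qed

context
  fixes \<theta> t :: real and h1 h2 :: "real^'n::{finite,linorder} \<Rightarrow> real" and \<xi> :: "real^'n::{finite,linorder}"
    and U1 U2 :: "(real^'n::{finite,linorder}) set"
  assumes \<theta>: "0 < \<theta>" "\<theta> < pi"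
    and U1: "open U1" "Ck 2 U1 h1" "cap \<theta> \<subseteq> U1"
    and U2: "open U2" "Ck 2 U2 h2" "cap \<theta> \<subseteq> U2"
    and le: "\<And>y. y \<in> cap \<theta> \<Longrightarrow> h1 y \<le> t * h2 y"
    and \<xi>: "\<xi> \<in> cap \<theta>" and touch: "h1 \<xi> = t * h2 \<xi>"
begin

abbreviation (input) "\<nu> \<equiv> sph_normal \<theta> \<xi>"

definition touch_lin :: "real^'n::{finite,linorder} \<Rightarrow> real" where
  "touch_lin v = (grad h1 \<xi> - t *\<^sub>R grad h2 \<xi>) \<bullet> v"

text \<open>The spherical Hessian of h1 - t h2 on tangent vectors. The last term is the curvature
  correction by the normal derivative; the zeroth-order part of W cancels at the touching
  point.\<close>

definition touch_quad :: "real^'n::{finite,linorder} \<Rightarrow> real" where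
  "touch_quad v = v \<bullet> (hess h1 \<xi> *v v) - t * (v \<bullet> (hess h2 \<xi> *v v)) - touch_lin \<nu> * (v \<bullet> v)"

text \<open>The one-sided test is applied to h1 - t h2 along the great circle with initial velocity
  v.\<close>

lemma touch_unit_inward:
  assumes v: "norm v = 1" "v \<bullet> \<nu> = 0" and inward: "\<xi> \<bullet> lastE > 0 \<or> v \<bullet> lastE > 0"
  shows "touch_lin v \<le> 0" and "touch_lin v = 0 \<Longrightarrow> touch_quad v \<le> 0"
proof -
  define \<gamma> where "\<gamma> = (\<lambda>s. cap_center \<theta> + cos s *\<^sub>R \<nu> + sin s *\<^sub>R v)"
  define \<gamma>' where "\<gamma>' = (\<lambda>s. cos s *\<^sub>R v - sin s *\<^sub>R \<nu>)"
  define g where "g = (\<lambda>s. h1 (\<gamma> s) - t * h2 (\<gamma> s))"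
  define g' where "g' = (\<lambda>s. grad h1 (\<gamma> s) \<bullet> \<gamma>' s - t * (grad h2 (\<gamma> s) \<bullet> \<gamma>' s))"
  have c\<nu>: "cap_center \<theta> + \<nu> = \<xi>" by (simp add: sph_normal_def)
  have \<gamma>0: "\<gamma> 0 = \<xi>" "\<gamma>' 0 = v" by (simp_all add: \<gamma>_def \<gamma>'_def c\<nu>)
  obtain d where d: "d > 0" "\<And>s. 0 \<le> s \<Longrightarrow> s < d \<Longrightarrow> \<gamma> s \<in> cap \<theta>"
    using great_circle_in_cap[OF \<xi> v inward] unfolding \<gamma>_def by blast
  have D: "(g has_real_derivative g' s) (at s)" if "0 \<le> s" "s < d" for s
    unfolding g_def g'_def \<gamma>_def \<gamma>'_def
    by (intro DERIV_diff DERIV_cmult great_circle_derivatives(1)[OF U1(1,2)] great_circle_derivatives(1)[OF U2(1,2)])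
       (use d(2)[OF that] U1(3) U2(3) in \<open>auto simp: \<gamma>_def\<close>)
  have "(g' has_real_derivative (v \<bullet> (hess h1 (cap_center \<theta> + \<nu>) *v v) - grad h1 (cap_center \<theta> + \<nu>) \<bullet> \<nu>)
      - t * (v \<bullet> (hess h2 (cap_center \<theta> + \<nu>) *v v) - grad h2 (cap_center \<theta> + \<nu>) \<bullet> \<nu>)) (at 0)"
    unfolding g'_def \<gamma>_def \<gamma>'_def
    by (intro DERIV_diff DERIV_cmult great_circle_derivatives(2)[OF U1(1,2)] great_circle_derivatives(2)[OF U2(1,2)])
       (use c\<nu> \<xi> U1(3) U2(3) in auto)
  then have D2: "(g' has_real_derivative touch_quad v) (at 0)"
    using v(1) unfolding c\<nu> touch_quad_def touch_lin_def
    by (simp add: inner_diff_left norm_eq_1 algebra_simps)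
  have le0: "g s \<le> g 0" if "0 \<le> s" "s < d" for s
    using le[OF d(2)[OF that]] touch by (simp add: g_def \<gamma>0)
  have g'0: "g' 0 = touch_lin v" by (simp add: g'_def \<gamma>0 touch_lin_def inner_diff_left)
  show "touch_lin v \<le> 0" "touch_lin v = 0 \<Longrightarrow> touch_quad v \<le> 0"
    using second_order_test_right[OF d(1) D D2 le0] unfolding g'0 by auto
qed

lemma touch_inward:
  assumes v: "v \<bullet> \<nu> = 0" and inward: "\<xi> \<bullet> lastE > 0 \<or> v \<bullet> lastE > 0"
  shows "touch_lin v \<le> 0" and "touch_lin v = 0 \<Longrightarrow> touch_quad v \<le> 0"
proof -
  have "touch_lin v \<le> 0 \<and> (touch_lin v = 0 \<longrightarrow> touch_quad v \<le> 0)"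
  proof (cases "v = 0")
    case True
    then show ?thesis by (simp add: touch_lin_def touch_quad_def)
  next
    case False
    define n where "n = norm v"
    define w where "w = v /\<^sub>R n"
    have n: "n > 0" and vw: "v = n *\<^sub>R w" using False by (auto simp: n_def w_def)
    have w: "norm w = 1" "w \<bullet> \<nu> = 0" using n v by (simp_all add: w_def n_def)
    have "\<xi> \<bullet> lastE > 0 \<or> w \<bullet> lastE > 0" using inward n by (simp add: w_def zero_less_mult_iff)
    from touch_unit_inward[OF w this]
    have *: "touch_lin w \<le> 0" "touch_lin w = 0 \<longrightarrow> touch_quad w \<le> 0" by auto
    have l: "touch_lin v = n * touch_lin w" by (simp add: vw touch_lin_def)
    have q: "touch_quad v = n\<^sup>2 * touch_quad w"
      by (simp add: vw touch_quad_def matrix_vector_mult_scaleR power2_eq_square algebra_simps)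
    show ?thesis unfolding l q using * n
      by (auto simp: mult_nonneg_nonpos)
  qed
  then show "touch_lin v \<le> 0" "touch_lin v = 0 \<Longrightarrow> touch_quad v \<le> 0" by auto
qed

text \<open>At a boundary point only inward curves are available.  The homogeneous Robin condition makes
  the conormal derivative of \<open>h1 - t * h2\<close> vanish, so subtracting multiples of \<open>\<mu>\<close> from a tangent
  vector turns it inward without changing the first derivative.\<close>
lemma touch_tangent:
  assumes bdry: "\<xi> \<in> cap_boundary \<theta> \<Longrightarrow> touch_lin (conormal \<theta> \<xi>) = 0"
    and v: "v \<bullet> \<nu> = 0"
  shows "touch_quad v \<le> 0"
proof -
  \<comment> \<open>Interior points take \<mu> = 0, so that both cases share the rest of the
    argument.\<close>
  obtain \<mu> where \<mu>: "\<mu> \<bullet> \<nu> = 0" "touch_lin \<mu> = 0" "\<xi> \<bullet> lastE > 0 \<or> \<mu> \<bullet> lastE < 0"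
  proof (cases "\<xi> \<bullet> lastE > 0")
    case True
    then show ?thesis using that[of 0] by (simp add: touch_lin_def)
  next
    case False
    then have "\<xi> \<in> cap_boundary \<theta>" using \<xi> by (auto simp: cap_def cap_boundary_def)
    from conormal_properties[OF \<theta> this] bdry[OF this] show ?thesis using that by blast
  qed
  have lin: "touch_lin (x - a *\<^sub>R \<mu>) = touch_lin x" for x a
    using \<mu>(2) by (simp add: touch_lin_def inner_diff_right)
  have neg: "touch_lin x \<le> 0" if x: "x \<bullet> \<nu> = 0" for x
  proof -
    \<comment> \<open>At a boundary point this choice raises the height component of x to x
      \<bullet> E + |x \<bullet> E| + 1 > 0, with E = \<open>lastE\<close>.\<close>
    define a where "a = (\<bar>x \<bullet> lastE\<bar> + 1) / - (\<mu> \<bullet> lastE)"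
    have "\<xi> \<bullet> lastE > 0 \<or> (x - a *\<^sub>R \<mu>) \<bullet> lastE > 0"
    proof (cases "\<xi> \<bullet> lastE > 0")
      case False
      then have "(x - a *\<^sub>R \<mu>) \<bullet> lastE = x \<bullet> lastE + (\<bar>x \<bullet> lastE\<bar> + 1)"
        using \<mu>(3) by (simp add: a_def inner_diff_left inner_add_left)
      then show ?thesis by linarith
    qed simp
    then have "touch_lin (x - a *\<^sub>R \<mu>) \<le> 0"
      using x \<mu>(1) by (intro touch_inward) (auto simp: inner_diff_left)
    then show ?thesis by (simp add: lin)
  qed
  have zero: "touch_lin x = 0" if "x \<bullet> \<nu> = 0" for x
    using neg[of x] neg[of "- x"] that by (simp add: touch_lin_def)
  have nonneg: "touch_quad x \<le> 0" if x: "x \<bullet> \<nu> = 0" "x \<bullet> lastE \<ge> 0" for x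
  proof -
    \<comment> \<open>A vector tangent to the boundary is not strictly inward, so it is tilted by -
      e \<mu> and e tends to 0.\<close>
    have "((\<lambda>e. touch_quad (x - e *\<^sub>R \<mu>)) \<longlongrightarrow> touch_quad (x - 0 *\<^sub>R \<mu>)) (at_right 0)"
      unfolding touch_quad_def
      unfolding touch_lin_def
      by (intro tendsto_intros bounded_linear.tendsto[OF matrix_vector_mul_bounded_linear])
    moreover have "eventually (\<lambda>e. touch_quad (x - e *\<^sub>R \<mu>) \<le> 0) (at_right 0)"
      using eventually_at_right_less[of 0]
    proof eventually_elim
      case (elim e)
      have "\<xi> \<bullet> lastE > 0 \<or> (x - e *\<^sub>R \<mu>) \<bullet> lastE > 0"
        using \<mu>(3) x(2) elim by (auto simp: inner_diff_left) (smt (verit) mult_pos_neg)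
      moreover have "(x - e *\<^sub>R \<mu>) \<bullet> \<nu> = 0" using x \<mu>(1) by (simp add: inner_diff_left)
      ultimately show ?case using touch_inward(2) zero by blast
    qed
    ultimately show ?thesis using tendsto_upperbound[of _ _ "at_right (0::real)" 0] by force
  qed
  \<comment> \<open>Evenness of the quadratic form covers outward vectors.\<close>
  have "touch_quad (- v) = touch_quad v" by (simp add: touch_quad_def vec.neg)
  then show ?thesis using nonneg[of v] nonneg[of "- v"] v by (cases "v \<bullet> lastE \<ge> 0") auto
qed

text \<open>Both quadratic forms depend only on the tangential part y of x, and their difference is
  \<open>touch_quad y\<close>.\<close>

lemma touch_Wmat_le:
  assumes bdry: "\<xi> \<in> cap_boundary \<theta> \<Longrightarrow> touch_lin (conormal \<theta> \<xi>) = 0"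
  shows "x \<bullet> (Wmat \<theta> h1 \<xi> *v x) \<le> t * (x \<bullet> (Wmat \<theta> h2 \<xi> *v x))"
proof -
  define y where "y = x - (\<nu> \<bullet> x) *\<^sub>R \<nu>"
  have "\<nu> \<bullet> \<nu> = 1" using \<xi> by (simp add: cap_def sph_normal_def norm_eq_1)
  moreover have "y \<bullet> \<nu> = x \<bullet> \<nu> - (\<nu> \<bullet> x) * (\<nu> \<bullet> \<nu>)"
    by (simp only: y_def inner_diff_left inner_scaleR_left)
  ultimately have "y \<bullet> \<nu> = 0" by (simp add: inner_commute)
  then have "touch_quad y \<le> 0" using touch_tangent[OF bdry] by blast
  then show ?thesis
    unfolding Wmat_quadratic_form y_def[symmetric] touch_quad_def touch_lin_def touch
    by (simp add: inner_diff_left algebra_simps)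
qed

end

section \<open>Uniqueness\<close>

lemma pos_adm_solution_le:
  fixes f h1 h2 :: "real^'n::{finite,linorder} \<Rightarrow> real"
  assumes lk: "l < k" and \<theta>: "0 < \<theta>" "\<theta> < pi" and p: "p > real k - real l + 1"
    and f: "\<forall>\<xi>\<in>cap \<theta>. f \<xi> > 0"
    and sol1: "is_pos_adm_solution k l \<theta> p f h1" and sol2: "is_pos_adm_solution k l \<theta> p f h2"
    and x: "x \<in> cap \<theta>"
  shows "h1 x \<le> h2 x"
proof -
  obtain U1 where U1: "open U1" "Ck 2 U1 h1" "cap \<theta> \<subseteq> U1"
    using sol1 unfolding is_pos_adm_solution_def admissible_def Ck_on_set_def by auto
  obtain U2 where U2: "open U2" "Ck 2 U2 h2" "cap \<theta> \<subseteq> U2"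
    using sol2 unfolding is_pos_adm_solution_def admissible_def Ck_on_set_def by auto
  have pos: "h1 y > 0" "h2 y > 0" if "y \<in> cap \<theta>" for y
    using sol1 sol2 that unfolding is_pos_adm_solution_def by auto
  have cont: "continuous_on (cap \<theta>) h1" "continuous_on (cap \<theta>) h2"
    using C2_differentiable[OF U1(1,2)] C2_differentiable[OF U2(1,2)] U1(3) U2(3)
    by (auto intro!: continuous_at_imp_continuous_on differentiable_imp_continuous_within)
  have "continuous_on (cap \<theta>) (\<lambda>y. h1 y / h2 y)"
    using cont pos(2) by (intro continuous_on_divide) (auto simp: less_imp_neq[symmetric])
  then obtain \<xi> where \<xi>: "\<xi> \<in> cap \<theta>" and max: "\<And>y. y \<in> cap \<theta> \<Longrightarrow> h1 y / h2 y \<le> h1 \<xi> / h2 \<xi>"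
    using continuous_attains_sup[OF compact_cap] x by blast
  define t where "t = h1 \<xi> / h2 \<xi>"
  have t: "t > 0" using pos[OF \<xi>] by (simp add: t_def)
  have touch: "h1 \<xi> = t * h2 \<xi>" using pos(2)[OF \<xi>] by (simp add: t_def)
  have le: "h1 y \<le> t * h2 y" if "y \<in> cap \<theta>" for y
    using max[OF that] pos(2)[OF that] by (simp add: t_def pos_divide_le_eq)
  \<comment> \<open>By the Robin condition this derivative is cot \<theta> (h1 - t h2), which is 0
    at the touching point.\<close>
  have "touch_lin t h1 h2 \<xi> (conormal \<theta> \<xi>) = 0" if b: "\<xi> \<in> cap_boundary \<theta>"
  proof -
    have "grad h1 \<xi> \<bullet> conormal \<theta> \<xi> = cot \<theta> * h1 \<xi>" "grad h2 \<xi> \<bullet> conormal \<theta> \<xi> = cot \<theta> * h2 \<xi>"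
      using sol1 sol2 b \<xi> U1(3) U2(3) frechet_derivative_eq_grad[OF C2_differentiable[OF U1(1,2)]]
        frechet_derivative_eq_grad[OF C2_differentiable[OF U2(1,2)]]
      unfolding is_pos_adm_solution_def by (metis subsetD)+
    then show ?thesis using touch by (simp add: touch_lin_def[OF \<theta> U1 U2 le \<xi> touch] inner_diff_left)
  qed
  note Wle = touch_Wmat_le[OF \<theta> U1 U2 le \<xi> touch this]
  let ?q = "\<lambda>h. sigma_mat k (Wmat \<theta> h \<xi>) / sigma_mat l (Wmat \<theta> h \<xi>)"
  have "?q h1 \<le> t ^ (k - l) * ?q h2"
  proof (rule sigma_mat_quotient_mono[OF _ _ Wle t _ lk])
    show "transpose (Wmat \<theta> h1 \<xi>) = Wmat \<theta> h1 \<xi>" "transpose (Wmat \<theta> h2 \<xi>) = Wmat \<theta> h2 \<xi>"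
      using C2_hess_symmetric[OF U1(1,2)] C2_hess_symmetric[OF U2(1,2)] \<xi> U1(3) U2(3)
      by (auto intro!: transpose_Wmat)
    show "\<forall>i\<in>{1..k}. sigma_mat i (Wmat \<theta> h1 \<xi>) > 0"
      using sol1 \<xi> unfolding is_pos_adm_solution_def admissible_def by blast
  qed
  moreover have "?q h1 = f \<xi> * h1 \<xi> powr (p - 1)" "?q h2 = f \<xi> * h2 \<xi> powr (p - 1)"
    using sol1 sol2 \<xi> unfolding is_pos_adm_solution_def by auto
  ultimately have "f \<xi> * h1 \<xi> powr (p - 1) \<le> t ^ (k - l) * (f \<xi> * h2 \<xi> powr (p - 1))" by simp
  also have "h1 \<xi> powr (p - 1) = t powr (p - 1) * h2 \<xi> powr (p - 1)"
    unfolding touch using t pos(2)[OF \<xi>] by (simp add: powr_mult)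
  also have "t ^ (k - l) = t powr (real k - real l)"
    using t lk by (simp add: powr_realpow[symmetric] of_nat_diff)
  finally have "(f \<xi> * h2 \<xi> powr (p - 1)) * t powr (p - 1)
      \<le> (f \<xi> * h2 \<xi> powr (p - 1)) * t powr (real k - real l)"
    by (simp only: mult_ac)
  moreover have "f \<xi> * h2 \<xi> powr (p - 1) > 0" using f \<xi> pos(2)[OF \<xi>] by simp
  ultimately have "t powr (p - 1) \<le> t powr (real k - real l)"
    by (rule mult_left_le_imp_le)
  \<comment> \<open>For t > 1 the power would be strictly increasing in the exponent, against p - 1
    > k - l.\<close>
  then have "t \<le> 1"
    using p by (metis less_diff_eq not_le powr_less_mono)
  then have "t * h2 x \<le> h2 x" using pos(2)[OF x] by simp
  then show ?thesis using le[OF x] by simp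
qed

theorem theorem5p1:
  fixes f h1 h2 :: "real^'n::{finite,linorder} \<Rightarrow> real"
    and k l :: nat and \<theta> p :: real
  assumes "CARD('n) \<ge> 3"
    and "l < k" and "k \<le> CARD('n) - 1"
    and "0 < \<theta>" and "\<theta> < pi"
    and "p > real k - real l + 1"
    and "smooth_on_set (cap \<theta>) f" and "\<forall>\<xi>\<in>cap \<theta>. f \<xi> > 0"
    and "is_pos_adm_solution k l \<theta> p f h1"
    and "is_pos_adm_solution k l \<theta> p f h2"
  shows "\<forall>\<xi>\<in>cap \<theta>. h1 \<xi> = h2 \<xi>"
  using pos_adm_solution_le[OF assms(2,4,5,6,8,9,10)] pos_adm_solution_le[OF assms(2,4,5,6,8,10,9)]
  by (auto intro: antisym)

end
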